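(* Let $R$ be a ring and let $M$ be a left $R$-module that is projective in $\sigma[M]$. If $Ler(\mathrm{Ann}_M(K))=\mathrm{Ann}_M(K)$ for all $K\in\Lambda^{fi}(M)$, then $\Psi(M)=(\Lambda^{fi}(M))^{reg}$, the regular core of $\Lambda^{fi}(M)$.
   Context: Rings are associative with identity, not necessarily commutative; modules are unital left modules. $\sigma[M]$ is the full subcategory of $R$-modules consisting of all modules that embed in an $M$-generated module (a quotient of a direct sum of copies of $M$). $M$ is projective in $\sigma[M]$ if for every epimorphism $X\to Y$ in $\sigma[M]$ the induced map $\mathrm{Hom}_R(M,X)\to\mathrm{Hom}_R(M,Y)$ is surjective. $\Lambda^{fi}(M)$ is the complete lattice of fully invariant submodules of $M$, i.e. submodules $N$ with $f(N)\subseteq N$ for all $f\in\mathrm{End}_R(M)$. For $N\leq M$ and a module $K$, $N_MK=\sum\{f(N)\mid f\in\mathrm{Hom}_R(M,K)\}$ and $\mathrm{Ann}_M(K)=\bigcap\{\ker f\mid f\in\mathrm{Hom}_R(M,K)\}$. When $M$ is projective in $\sigma[M]$, $\Lambda^{fi}(M)$ with the product $(N,L)\mapsto N_ML$ is an idiomatic-quantale (an upper-continuous modular complete lattice with an associative product distributing over arbitrary suprema on both sides). $\Psi(M)=\{N\in\Lambda^{fi}(M)\mid N+\mathrm{Ann}_M(Rn)=M\text{ for all }n\in N\}$. For $N\in\Lambda^{fi}(M)$, $Ler(N)=\{m\in M\mid N+\mathrm{Ann}_M(Rm)=M\}$. Regular core: for an idiomatic-quantale $A$ with top $1$ and bottom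 $0$, define $r\colon A\to A$ by $r(a)=\bigvee\{x\in A\mid a\vee x^r=1\}$, where $x^r=\bigvee\{y\in A\mid yx=0\}$, and let $A^r=\{a\in A\mid r(a)=a\}$. Now $A^r$ has its own operator $r$ (defined by the same formulas with all elements taken in $A^r$), so one can iterate: $A^{r(0)}=A$, $A^{r(\alpha+1)}=(A^{r(\alpha)})^r$, and $A^{r(\lambda)}=\bigcap\{A^{r(\alpha)}\mid\alpha<\lambda\}$ for limit ordinals $\lambda$. This decreasing chain stabilizes at some least ordinal $\infty$; the regular core is $A^{reg}=A^{r(\infty)}$. *)

theory Defs
  imports
    "HOL-Algebra.Module"
    "HOL-Algebra.AbelCoset"
    "HOL-Algebra.Generated_Groups"
    "HOL-Algebra.Complete_Lattice"
    "HOL-Library.FuncSet"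
    "HOL-Library.Countable_Set"
begin

section \<open>Left modules over a ring that need not be commutative\<close>

text \<open>The locale \<^locale>\<open>module\<close> of the library requires a commutative ring; this is the
  same list of axioms over an arbitrary ring.\<close>

locale left_module = R?: ring R + M?: abelian_group M
  for R :: "('r, 'q) ring_scheme" (structure)
    and M :: "('r, 'm, 's) module_scheme" (structure) +
  assumes smult_closed [simp, intro]:
      "\<lbrakk>a \<in> carrier R; x \<in> carrier M\<rbrakk> \<Longrightarrow> a \<odot>\<^bsub>M\<^esub> x \<in> carrier M"
    and smult_l_distr:
      "\<lbrakk>a \<in> carrier R; b \<in> carrier R; x \<in> carrier M\<rbrakk> \<Longrightarrow>
        (a \<oplus>\<^bsub>R\<^esub> b) \<odot>\<^bsub>M\<^esub> x = a \<odot>\<^bsub>M\<^esub> x \<oplus>\<^bsub>M\<^esub> b \<odot>\<^bsub>M\<^esub> x"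
    and smult_r_distr:
      "\<lbrakk>a \<in> carrier R; x \<in> carrier M; y \<in> carrier M\<rbrakk> \<Longrightarrow>
        a \<odot>\<^bsub>M\<^esub> (x \<oplus>\<^bsub>M\<^esub> y) = a \<odot>\<^bsub>M\<^esub> x \<oplus>\<^bsub>M\<^esub> a \<odot>\<^bsub>M\<^esub> y"
    and smult_assoc1:
      "\<lbrakk>a \<in> carrier R; b \<in> carrier R; x \<in> carrier M\<rbrakk> \<Longrightarrow>
        (a \<otimes>\<^bsub>R\<^esub> b) \<odot>\<^bsub>M\<^esub> x = a \<odot>\<^bsub>M\<^esub> (b \<odot>\<^bsub>M\<^esub> x)"
    and smult_one [simp]:
      "x \<in> carrier M \<Longrightarrow> \<one>\<^bsub>R\<^esub> \<odot>\<^bsub>M\<^esub> x = x"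

text \<open>Homomorphisms are functions on the whole type of which only the values on the carrier matter.
  A submodule \<open>K\<close> of \<open>M\<close>, regarded as a module, is \<open>M\<lparr>carrier := K\<rparr>\<close>.\<close>

definition lmod_hom ::
  "('r, 'q) ring_scheme \<Rightarrow> ('r, 'm, 's) module_scheme \<Rightarrow> ('r, 'n, 't) module_scheme \<Rightarrow> ('m \<Rightarrow> 'n) set"
  where "lmod_hom R M N = {f \<in> carrier M \<rightarrow> carrier N.
    (\<forall>x\<in>carrier M. \<forall>y\<in>carrier M. f (x \<oplus>\<^bsub>M\<^esub> y) = f x \<oplus>\<^bsub>N\<^esub> f y) \<and>
    (\<forall>a\<in>carrier R. \<forall>x\<in>carrier M. f (a \<odot>\<^bsub>M\<^esub> x) = a \<odot>\<^bsub>N\<^esub> f x)}"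

text \<open>The fields \<open>mult\<close> and \<open>one\<close> of a module record carry no meaning.\<close>

definition direct_sum_copies :: "('r, 'm, 's) module_scheme \<Rightarrow> 'i set \<Rightarrow> ('r, 'i \<Rightarrow> 'm) module"
  where "direct_sum_copies M I =
    \<lparr>carrier = {t \<in> I \<rightarrow>\<^sub>E carrier M. finite {i \<in> I. t i \<noteq> \<zero>\<^bsub>M\<^esub>}},
     mult = undefined, one = undefined,
     zero = (\<lambda>i\<in>I. \<zero>\<^bsub>M\<^esub>), add = (\<lambda>t u. \<lambda>i\<in>I. t i \<oplus>\<^bsub>M\<^esub> u i),
     smult = (\<lambda>a t. \<lambda>i\<in>I. a \<odot>\<^bsub>M\<^esub> t i)\<rparr>"

definition generated_by_copies ::
  "('r, 'q) ring_scheme \<Rightarrow> ('r, 'm, 's) module_scheme \<Rightarrow> 'i set \<Rightarrow> ('r, 'p, 't) module_scheme \<Rightarrow> bool"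
  where "generated_by_copies R M I P \<longleftrightarrow> left_module R P \<and>
    (\<exists>g\<in>lmod_hom R (direct_sum_copies M I) P. g ` carrier (direct_sum_copies M I) = carrier P)"

section \<open>The category \<open>\<sigma>[M]\<close> and projectivity in it\<close>

text \<open>HOL cannot quantify over types inside a formula, so \<open>\<sigma>[M]\<close> is formed inside one fixed
  universe: the modules whose carrier is a set of finite sequences in \<open>M \<times> \<nat>\<close>. Lifting problems
  for homomorphisms out of \<open>M\<close> only involve modules of cardinality at most \<open>max |M| \<aleph>\<^sub>0\<close>, so
  this is no restriction: the theorem \<open>projective_in_sigma_lift\<close> below shows that projectivity
  with respect to this universe gives the lifting property for modules in \<open>\<sigma>[M]\<close> on
  arbitrary types.\<close>

type_synonym 'm seqs = "('m \<times> nat) list"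

definition sigma ::
  "('r, 'q) ring_scheme \<Rightarrow> ('r, 'm, 's) module_scheme \<Rightarrow> ('r, 'm seqs) module set"
  where "sigma R M = {X. left_module R X \<and>
    (\<exists>(P :: ('r, 'm seqs) module) (I :: 'm seqs set). generated_by_copies R M I P \<and>
      (\<exists>e\<in>lmod_hom R X P. inj_on e (carrier X)))}"

definition projective_in_sigma :: "('r, 'q) ring_scheme \<Rightarrow> ('r, 'm, 's) module_scheme \<Rightarrow> bool"
  where "projective_in_sigma R M \<longleftrightarrow>
    (\<forall>X\<in>sigma R M. \<forall>Y\<in>sigma R M. \<forall>g\<in>lmod_hom R X Y. g ` carrier X = carrier Y \<longrightarrow>
      (\<forall>f\<in>lmod_hom R M Y. \<exists>h\<in>lmod_hom R M X. \<forall>m\<in>carrier M. g (h m) = f m))"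

section \<open>Fully invariant submodules, annihilators and products\<close>

definition fully_invariant :: "('r, 'q) ring_scheme \<Rightarrow> ('r, 'm, 's) module_scheme \<Rightarrow> 'm set set"
  where "fully_invariant R M = {N. submodule N R M \<and> (\<forall>f\<in>lmod_hom R M M. f ` N \<subseteq> N)}"

definition Ann ::
  "('r, 'q) ring_scheme \<Rightarrow> ('r, 'm, 's) module_scheme \<Rightarrow> ('r, 'k, 't) module_scheme \<Rightarrow> 'm set"
  where "Ann R M K = {m \<in> carrier M. \<forall>f\<in>lmod_hom R M K. f m = \<zero>\<^bsub>K\<^esub>}"

text \<open>\<open>N\<^sub>MK\<close>: the additive subgroup generated by the images is their sum, already a submodule.\<close>

definition submod_prod ::
  "('r, 'q) ring_scheme \<Rightarrow> ('r, 'm, 's) module_scheme \<Rightarrow> 'm set \<Rightarrow> ('r, 'k, 't) module_scheme \<Rightarrow> 'k set"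
  where "submod_prod R M N K = generate (add_monoid K) (\<Union>f\<in>lmod_hom R M K. f ` N)"

definition cyclic :: "('r, 'q) ring_scheme \<Rightarrow> ('r, 'm, 's) module_scheme \<Rightarrow> 'm \<Rightarrow> 'm set"
  where "cyclic R M m = {a \<odot>\<^bsub>M\<^esub> m | a. a \<in> carrier R}"

definition Psi :: "('r, 'q) ring_scheme \<Rightarrow> ('r, 'm, 's) module_scheme \<Rightarrow> 'm set set"
  where "Psi R M = {N \<in> fully_invariant R M.
    \<forall>n\<in>N. N <+>\<^bsub>M\<^esub> Ann R M (M\<lparr>carrier := cyclic R M n\<rparr>) = carrier M}"

definition Ler :: "('r, 'q) ring_scheme \<Rightarrow> ('r, 'm, 's) module_scheme \<Rightarrow> 'm set \<Rightarrow> 'm set"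
  where "Ler R M N = {m \<in> carrier M.
    N <+>\<^bsub>M\<^esub> Ann R M (M\<lparr>carrier := cyclic R M m\<rparr>) = carrier M}"

section \<open>The regular core of an idiomatic-quantale\<close>

record 'a quantale = "'a gorder" +
  qmult :: "'a \<Rightarrow> 'a \<Rightarrow> 'a" (infixl \<open>\<star>\<index>\<close> 70)

definition fi_quantale ::
  "('r, 'q) ring_scheme \<Rightarrow> ('r, 'm, 's) module_scheme \<Rightarrow> 'm set quantale"
  where "fi_quantale R M = \<lparr>carrier = fully_invariant R M, eq = (=), le = (\<subseteq>),
    qmult = (\<lambda>N L. submod_prod R M N (M\<lparr>carrier := L\<rparr>))\<rparr>"

definition r_compl :: "('a, 'c) quantale_scheme \<Rightarrow> 'a \<Rightarrow> 'a"
  where "r_compl A x = \<Squnion>\<^bsub>A\<^esub>{y \<in> carrier A. y \<star>\<^bsub>A\<^esub> x = \<bottom>\<^bsub>A\<^esub>}"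

definition r_op :: "('a, 'c) quantale_scheme \<Rightarrow> 'a \<Rightarrow> 'a"
  where "r_op A a = \<Squnion>\<^bsub>A\<^esub>{x \<in> carrier A. a \<squnion>\<^bsub>A\<^esub> r_compl A x = \<top>\<^bsub>A\<^esub>}"

definition r_fixed :: "('a, 'c) quantale_scheme \<Rightarrow> 'a set"
  where "r_fixed A = {a \<in> carrier A. r_op A a = a}"

text \<open>The chain \<open>A\<^bsup>r(\<alpha>)\<^esup>\<close>, with the ordinals \<open>\<alpha>\<close> represented by the elements of a
  well-order \<open>\<rho>\<close>. An element \<open>i\<close> is a successor, of \<open>j\<close>, iff the elements strictly below \<open>i\<close>
  are those weakly below \<open>j\<close>. Each \<open>A\<^bsup>r(\<alpha>)\<^esup>\<close> is a structure of its own, with the order and the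
  product of \<open>A\<close> restricted to it; its operator \<open>r\<close> is \<open>r_op (A\<lparr>carrier := A\<^bsup>r(\<alpha>)\<^esup>\<rparr>)\<close>,
  with suprema, \<open>0\<close> and \<open>1\<close> taken in \<open>A\<^bsup>r(\<alpha>)\<^esup>\<close>.\<close>

definition r_step ::
  "('a, 'c) quantale_scheme \<Rightarrow> 'i rel \<Rightarrow> ('i \<Rightarrow> 'a set) \<Rightarrow> 'i \<Rightarrow> 'a set"
  where "r_step A \<rho> S i =
    (if underS \<rho> i = {} then carrier A
     else if \<exists>j. underS \<rho> i = under \<rho> j
       then r_fixed (A\<lparr>carrier := S (THE j. underS \<rho> i = under \<rho> j)\<rparr>)
     else (\<Inter>j\<in>underS \<rho> i. S j))"

definition r_stage :: "('a, 'c) quantale_scheme \<Rightarrow> 'i rel \<Rightarrow> 'i \<Rightarrow> 'a set"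
  where "r_stage A \<rho> = wo_rel.worec \<rho> (r_step A \<rho>)"

text \<open>For the core, \<open>\<rho>\<close> is the cardinal successor of \<open>|A|\<close>: a chain of subsets of \<open>A\<close> that is
  decreasing stabilizes before that (lemma \<open>r_stage_stabilizes\<close>). \<open>r_infinity\<close> is the least
  stable ordinal.\<close>

definition r_infinity :: "('a, 'c) quantale_scheme \<Rightarrow> 'a set"
  where "r_infinity A = (let \<rho> = cardSuc (card_of (carrier A)) in
    wo_rel.minim \<rho> {i \<in> Field \<rho>. r_fixed (A\<lparr>carrier := r_stage A \<rho> i\<rparr>) = r_stage A \<rho> i})"

definition regular_core :: "('a, 'c) quantale_scheme \<Rightarrow> 'a set"
  where "regular_core A = r_stage A (cardSuc (card_of (carrier A))) (r_infinity A)"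

subsection \<open>The chain stabilizes\<close>

lemma r_fixed_subset: "r_fixed (A\<lparr>carrier := S\<rparr>) \<subseteq> S"
  by (auto simp: r_fixed_def)

lemma the_pred:
  assumes "wo_rel \<rho>" "underS \<rho> i \<noteq> {}" "underS \<rho> i = under \<rho> j"
  shows "(THE j. underS \<rho> i = under \<rho> j) = j" "j \<in> underS \<rho> i"
proof -
  interpret wo_rel \<rho> by fact
  have mem: "k \<in> under k" if "underS i = under k" for k
    using that assms(2) REFL by (auto simp: under_def refl_on_def Field_def)
  then show "j \<in> underS i"
    using assms(3) by blast
  show "(THE j. underS i = under j) = j"
  proof (rule the_equality[of "\<lambda>j. underS i = under j", OF assms(3)])
    fix k assume k: "underS i = under k"
    then have "k \<in> under j" "j \<in> under k"
      using mem assms(3) by auto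
    then show "k = j"
      using ANTISYM by (auto simp: under_def antisym_def)
  qed
qed

lemma r_stage_unfold:
  assumes "wo_rel \<rho>"
  shows "r_stage A \<rho> i = r_step A \<rho> (r_stage A \<rho>) i"
proof -
  interpret wo_rel \<rho> by fact
  have "adm_wo (r_step A \<rho>)"
    unfolding adm_wo_def
  proof (intro allI impI)
    fix f g :: "'a \<Rightarrow> 'b set" and x
    assume eq: "\<forall>y\<in>underS x. f y = g y"
    show "r_step A \<rho> f x = r_step A \<rho> g x"
    proof (cases "underS x \<noteq> {} \<and> (\<exists>j. underS x = under j)")
      case True
      then obtain j where j: "underS x = under j" by blast
      have "f (THE j. underS x = under j) = g (THE j. underS x = under j)"
        using the_pred[OF assms conjunct1[OF True] j] eq by simp
      then show ?thesis
        using True unfolding r_step_def by auto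
    qed (use eq in \<open>auto simp: r_step_def\<close>)
  qed
  then show ?thesis
    unfolding r_stage_def using worec_fixpoint by metis
qed

lemma r_stage_zero:
  assumes "wo_rel \<rho>" "underS \<rho> i = {}"
  shows "r_stage A \<rho> i = carrier A"
  by (simp add: r_stage_unfold[OF assms(1)] r_step_def assms(2))

lemma r_stage_suc:
  assumes "wo_rel \<rho>" "underS \<rho> i \<noteq> {}" "underS \<rho> i = under \<rho> j"
  shows "r_stage A \<rho> i = r_fixed (A\<lparr>carrier := r_stage A \<rho> j\<rparr>)"
  using assms(2) the_pred[OF assms]
  by (subst r_stage_unfold[OF assms(1)], simp only: r_step_def) (use assms(3) in auto)

lemma r_stage_limit:
  assumes "wo_rel \<rho>" "underS \<rho> i \<noteq> {}" "\<nexists>j. underS \<rho> i = under \<rho> j"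
  shows "r_stage A \<rho> i = (\<Inter>j\<in>underS \<rho> i. r_stage A \<rho> j)"
  using assms(2,3)
  by (subst r_stage_unfold[OF assms(1)], simp only: r_step_def) auto

lemma r_stage_decreasing:
  assumes "wo_rel \<rho>" "j \<in> underS \<rho> i"
  shows "r_stage A \<rho> i \<subseteq> r_fixed (A\<lparr>carrier := r_stage A \<rho> j\<rparr>)"
proof -
  interpret wo_rel \<rho> by fact
  show ?thesis
    using assms(2)
  proof (induction i arbitrary: j rule: well_order_induct)
    case (1 i)
    then have IH: "\<And>k j. k \<in> underS i \<Longrightarrow> j \<in> underS k \<Longrightarrow>
        r_stage A \<rho> k \<subseteq> r_fixed (A\<lparr>carrier := r_stage A \<rho> j\<rparr>)"
      by (auto simp: underS_def)
    have ne: "underS i \<noteq> {}"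
      using 1 by auto
    show ?case
    proof (cases "\<exists>k. underS i = under k")
      case True
      then obtain k where k: "underS i = under k" by blast
      have eq: "r_stage A \<rho> i = r_fixed (A\<lparr>carrier := r_stage A \<rho> k\<rparr>)"
        by (rule r_stage_suc[OF assms(1) ne k])
      have "j = k \<or> j \<in> underS k"
        using 1 k by (auto simp: under_def underS_def)
      then show ?thesis
        using eq IH[OF the_pred(2)[OF assms(1) ne k], of j] r_fixed_subset[where A = A and S = "r_stage A \<rho> k"]
        by auto
    next
      case False
      then have "underS i \<noteq> under j"
        by blast
      moreover have "under j \<subseteq> underS i"
        using 1(2) TRANS ANTISYM unfolding under_def underS_def
        by (auto dest: transD antisymD)
      ultimately obtain x where x: "x \<in> underS i" "x \<notin> under j"
        by blast
      have F: "j \<in> Field \<rho>" "x \<in> Field \<rho>"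
        using x(1) 1(2) by (auto simp: underS_def intro: FieldI1)
      have nx: "(x, j) \<notin> \<rho>"
        using x(2) by (simp add: under_def)
      then have "(j, x) \<in> \<rho>" "j \<noteq> x"
        using TOTALS F by auto
      then have "j \<in> underS x"
        by (simp add: underS_def)
      then show ?thesis
        using IH[OF x(1), of j] r_stage_limit[OF assms(1) ne False, of A] x(1) by auto
    qed
  qed
qed

lemma wo_rel_cardSuc: "wo_rel (cardSuc (card_of B))"
  using cardSuc_Card_order[OF card_of_Card_order, of B] by (simp add: card_order_on_def wo_rel_def)

theorem r_stage_stabilizes:
  "\<exists>i\<in>Field (cardSuc (card_of (carrier A))).
    r_fixed (A\<lparr>carrier := r_stage A (cardSuc (card_of (carrier A))) i\<rparr>) =
    r_stage A (cardSuc (card_of (carrier A))) i"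
proof (rule ccontr)
  define \<rho> where "\<rho> = cardSuc (card_of (carrier A))"
  assume "\<not> ?thesis"
  then have "\<exists>x. x \<in> r_stage A \<rho> i - r_fixed (A\<lparr>carrier := r_stage A \<rho> i\<rparr>)" if "i \<in> Field \<rho>" for i
    using that r_fixed_subset[where A = A and S = "r_stage A \<rho> i"] unfolding \<rho>_def by blast
  then obtain e where e: "\<And>i. i \<in> Field \<rho> \<Longrightarrow>
      e i \<in> r_stage A \<rho> i - r_fixed (A\<lparr>carrier := r_stage A \<rho> i\<rparr>)"
    by metis
  interpret wo_rel \<rho>
    unfolding \<rho>_def by (rule wo_rel_cardSuc)
  note wo = wo_rel_axioms
  have neq: "e i \<noteq> e j" if "i \<in> Field \<rho>" "j \<in> Field \<rho>" "j \<in> underS i" for i j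
    using e[OF that(1)] e[OF that(2)] r_stage_decreasing[OF wo that(3), where A = A] by auto
  have "inj_on e (Field \<rho>)"
  proof (intro inj_onI, rule ccontr)
    fix i j assume ij: "i \<in> Field \<rho>" "j \<in> Field \<rho>" "e i = e j" "i \<noteq> j"
    then have "j \<in> underS i \<or> i \<in> underS j"
      using TOTALS by (auto simp: underS_def)
    then show False
      using neq[of i j] neq[of j i] ij by auto
  qed
  moreover have "r_stage A \<rho> i \<subseteq> carrier A" if "i \<in> Field \<rho>" for i
  proof (cases "underS i = {}")
    case False
    define z where "z = minim (Field \<rho>)"
    have F: "Field \<rho> \<subseteq> Field \<rho>" "Field \<rho> \<noteq> {}"
      using that by auto
    have z: "z \<in> Field \<rho>" "\<And>k. k \<in> Field \<rho> \<Longrightarrow> (z, k) \<in> \<rho>"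
      unfolding z_def using minim_in[OF F] minim_least[OF F(1)] by auto
    have z0: "underS z = {}"
      using z(2) ANTISYM unfolding underS_def by (auto dest: antisymD intro: FieldI1)
    then have "z \<in> underS i"
      using z(2)[OF that] False by (auto simp: underS_def)
    then show ?thesis
      using r_stage_decreasing[OF wo, of z i, where A = A]
        r_fixed_subset[where A = A and S = "carrier A"] r_stage_zero[OF wo z0, where A = A]
      by auto
  qed (simp add: r_stage_zero[OF wo])
  then have "e ` Field \<rho> \<subseteq> carrier A"
    using e by blast
  ultimately have "(card_of (Field \<rho>), card_of (carrier A)) \<in> ordLeq"
    using card_of_ordLeq by blast
  moreover have "(card_of (Field \<rho>), \<rho>) \<in> ordIso"
    unfolding \<rho>_def by (rule card_of_Field_ordIso[OF cardSuc_Card_order[OF card_of_Card_order]])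
  moreover have "(card_of (carrier A), \<rho>) \<in> ordLess"
    unfolding \<rho>_def by (rule cardSuc_greater[OF card_of_Card_order])
  ultimately show False
    by (metis not_ordLess_ordLeq ordIso_ordLeq_trans ordIso_symmetric ordLess_ordIso_trans)
qed

section \<open>Independence of \<open>projective_in_sigma\<close> from the universe\<close>

context left_module begin

lemma smult_zero_right:
  assumes "a \<in> carrier R" shows "a \<odot>\<^bsub>M\<^esub> \<zero>\<^bsub>M\<^esub> = \<zero>\<^bsub>M\<^esub>"
  using smult_r_distr[OF assms, of "\<zero>\<^bsub>M\<^esub>" "\<zero>\<^bsub>M\<^esub>"] assms M.r_zero M.add.r_cancel_one'
    by (metis M.zero_closed smult_closed)

end

lemma hom_zero:
  assumes "left_module R M" "left_module R N" "f \<in> lmod_hom R M N"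
  shows "f \<zero>\<^bsub>M\<^esub> = \<zero>\<^bsub>N\<^esub>"
proof -
  interpret M: left_module R M by fact
  interpret N: left_module R N by fact
  have "f \<zero>\<^bsub>M\<^esub> \<in> carrier N" "f (\<zero>\<^bsub>M\<^esub> \<oplus>\<^bsub>M\<^esub> \<zero>\<^bsub>M\<^esub>) = f \<zero>\<^bsub>M\<^esub> \<oplus>\<^bsub>N\<^esub> f \<zero>\<^bsub>M\<^esub>"
    using assms(3) by (auto simp: lmod_hom_def Pi_def simp del: M.r_zero M.l_zero)
  then show ?thesis
    by (metis M.zero_closed M.M.l_zero N.M.add.r_cancel_one')
qed

lemma homD:
  assumes "f \<in> lmod_hom R M N"
  shows "x \<in> carrier M \<Longrightarrow> f x \<in> carrier N"
    and "x \<in> carrier M \<Longrightarrow> y \<in> carrier M \<Longrightarrow> f (x \<oplus>\<^bsub>M\<^esub> y) = f x \<oplus>\<^bsub>N\<^esub> f y"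
    and "a \<in> carrier R \<Longrightarrow> x \<in> carrier M \<Longrightarrow> f (a \<odot>\<^bsub>M\<^esub> x) = a \<odot>\<^bsub>N\<^esub> f x"
  using assms by (auto simp: lmod_hom_def)

lemma homI:
  assumes "\<And>x. x \<in> carrier M \<Longrightarrow> f x \<in> carrier N"
    and "\<And>x y. x \<in> carrier M \<Longrightarrow> y \<in> carrier M \<Longrightarrow> f (x \<oplus>\<^bsub>M\<^esub> y) = f x \<oplus>\<^bsub>N\<^esub> f y"
    and "\<And>a x. a \<in> carrier R \<Longrightarrow> x \<in> carrier M \<Longrightarrow> f (a \<odot>\<^bsub>M\<^esub> x) = a \<odot>\<^bsub>N\<^esub> f x"
  shows "f \<in> lmod_hom R M N"
  using assms by (auto simp: lmod_hom_def)

lemma submoduleD: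
  assumes "submodule S R X"
  shows "x \<in> S \<Longrightarrow> x \<in> carrier X" "\<zero>\<^bsub>X\<^esub> \<in> S" "x \<in> S \<Longrightarrow> y \<in> S \<Longrightarrow> x \<oplus>\<^bsub>X\<^esub> y \<in> S"
    "x \<in> S \<Longrightarrow> \<ominus>\<^bsub>X\<^esub> x \<in> S" "a \<in> carrier R \<Longrightarrow> x \<in> S \<Longrightarrow> a \<odot>\<^bsub>X\<^esub> x \<in> S"
proof -
  interpret submodule S R X by fact
  show "x \<in> S \<Longrightarrow> x \<in> carrier X" "\<zero>\<^bsub>X\<^esub> \<in> S" "x \<in> S \<Longrightarrow> y \<in> S \<Longrightarrow> x \<oplus>\<^bsub>X\<^esub> y \<in> S"
    "x \<in> S \<Longrightarrow> \<ominus>\<^bsub>X\<^esub> x \<in> S" "a \<in> carrier R \<Longrightarrow> x \<in> S \<Longrightarrow> a \<odot>\<^bsub>X\<^esub> x \<in> S"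
    using subset one_closed m_closed[of x y] m_inv_closed[of x] by (auto simp: a_inv_def)
qed

lemma left_submoduleI:
  assumes X: "left_module R X"
  assumes "\<And>x. x \<in> S \<Longrightarrow> x \<in> carrier X" "\<zero>\<^bsub>X\<^esub> \<in> S" "\<And>x y. x \<in> S \<Longrightarrow> y \<in> S \<Longrightarrow> x \<oplus>\<^bsub>X\<^esub> y \<in> S"
    "\<And>a x. a \<in> carrier R \<Longrightarrow> x \<in> S \<Longrightarrow> a \<odot>\<^bsub>X\<^esub> x \<in> S"
  shows "submodule S R X"
proof -
  interpret left_module R X by fact
  have "\<ominus>\<^bsub>X\<^esub> x \<in> S" if "x \<in> S" for x
  proof -
    have x: "x \<in> carrier X" using assms(2) that .
    have "(\<ominus>\<^bsub>R\<^esub> \<one>\<^bsub>R\<^esub>) \<odot>\<^bsub>X\<^esub> x \<oplus>\<^bsub>X\<^esub> x = (\<ominus>\<^bsub>R\<^esub> \<one>\<^bsub>R\<^esub> \<oplus>\<^bsub>R\<^esub> \<one>\<^bsub>R\<^esub>) \<odot>\<^bsub>X\<^esub> x"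
      using x smult_l_distr[of "\<ominus>\<^bsub>R\<^esub> \<one>\<^bsub>R\<^esub>" "\<one>\<^bsub>R\<^esub>" x] by simp
    also have "\<dots> = \<zero>\<^bsub>R\<^esub> \<odot>\<^bsub>X\<^esub> x"
      by (simp add: R.l_neg)
    also have "\<dots> = \<zero>\<^bsub>X\<^esub>"
      using smult_l_distr[of "\<zero>\<^bsub>R\<^esub>" "\<zero>\<^bsub>R\<^esub>" x] x
      by (metis M.add.r_cancel_one' R.l_zero R.zero_closed smult_closed)
    finally have "\<ominus>\<^bsub>X\<^esub> x = (\<ominus>\<^bsub>R\<^esub> \<one>\<^bsub>R\<^esub>) \<odot>\<^bsub>X\<^esub> x"
      using x by (intro M.minus_equality) auto
    then show ?thesis
      using assms(5)[of "\<ominus>\<^bsub>R\<^esub> \<one>\<^bsub>R\<^esub>" x] that by simp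
  qed
  then show ?thesis
    using assms(2-5)
    by (intro submodule.intro subgroup.intro submodule_axioms.intro)
      (auto simp: a_inv_def[symmetric])
qed

text \<open>Transport of a submodule along an injection, as a module on another type.\<close>

definition transport ::
  "('r, 'x, 't) module_scheme \<Rightarrow> 'x set \<Rightarrow> ('x \<Rightarrow> 'u) \<Rightarrow> ('r, 'u) module"
  where "transport X S \<phi> = (let \<psi> = inv_into S \<phi> in
    \<lparr>carrier = \<phi> ` S, mult = undefined, one = undefined,
     zero = \<phi> \<zero>\<^bsub>X\<^esub>, add = (\<lambda>u v. \<phi> (\<psi> u \<oplus>\<^bsub>X\<^esub> \<psi> v)), smult = (\<lambda>a u. \<phi> (a \<odot>\<^bsub>X\<^esub> \<psi> u))\<rparr>)"

lemma transport:
  assumes X: "left_module R X" and S: "submodule S R X" and inj: "inj_on \<phi> S"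
  shows "left_module R (transport X S \<phi>)" (is ?A)
    and "inv_into S \<phi> \<in> lmod_hom R (transport X S \<phi>) X" (is ?B)
    and "\<And>x y. x \<in> S \<Longrightarrow> y \<in> S \<Longrightarrow> \<phi> (x \<oplus>\<^bsub>X\<^esub> y) = \<phi> x \<oplus>\<^bsub>transport X S \<phi>\<^esub> \<phi> y"
    and "\<And>a x. a \<in> carrier R \<Longrightarrow> x \<in> S \<Longrightarrow> \<phi> (a \<odot>\<^bsub>X\<^esub> x) = a \<odot>\<^bsub>transport X S \<phi>\<^esub> \<phi> x"
    and "carrier (transport X S \<phi>) = \<phi> ` S"
proof -
  interpret X: left_module R X by fact
  have sub: "\<And>x. x \<in> S \<Longrightarrow> x \<in> carrier X"
    and z: "\<zero>\<^bsub>X\<^esub> \<in> S" and add: "\<And>x y. x \<in> S \<Longrightarrow> y \<in> S \<Longrightarrow> x \<oplus>\<^bsub>X\<^esub> y \<in> S"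
    and neg: "\<And>x. x \<in> S \<Longrightarrow> \<ominus>\<^bsub>X\<^esub> x \<in> S"
    and sm: "\<And>a x. a \<in> carrier R \<Longrightarrow> x \<in> S \<Longrightarrow> a \<odot>\<^bsub>X\<^esub> x \<in> S"
    using submoduleD[OF S] by auto
  have inv[simp]: "\<And>x. x \<in> S \<Longrightarrow> inv_into S \<phi> (\<phi> x) = x"
    using inj by simp
  have "abelian_group (transport X S \<phi>)"
  proof (rule abelian_groupI)
    fix x assume "x \<in> carrier (transport X S \<phi>)"
    then obtain x' where x': "x' \<in> S" "x = \<phi> x'"
      by (auto simp: transport_def Let_def)
    then show "\<exists>y\<in>carrier (transport X S \<phi>). y \<oplus>\<^bsub>transport X S \<phi>\<^esub> x = \<zero>\<^bsub>transport X S \<phi>\<^esub>"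
      by (intro bexI[of _ "\<phi> (\<ominus>\<^bsub>X\<^esub> x')"]) (auto simp: transport_def Let_def neg X.M.l_neg sub)
  qed (auto simp: transport_def Let_def add z sub X.M.a_assoc intro!: X.M.a_comm arg_cong[where f = \<phi>])
  then show ?A
    by (intro left_module.intro X.R.ring_axioms left_module_axioms.intro)
      (auto simp: transport_def Let_def add z sub sm X.smult_l_distr X.smult_r_distr X.smult_assoc1)
  show ?B
    by (auto simp: lmod_hom_def transport_def Let_def add sm sub)
qed (use submoduleD[OF S] inj in \<open>auto simp: transport_def Let_def\<close>)

definition enc_block :: "'m seqs \<times> nat \<times> 'm \<Rightarrow> 'm seqs"
  where "enc_block = (\<lambda>(l, k, a). (a, k) # (a, length l) # l)"

lemma inj_enc_list: "inj (\<lambda>xs. concat (map enc_block xs))"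
proof (rule injI)
  fix xs ys :: "('m seqs \<times> nat \<times> 'm) list"
  assume "concat (map enc_block xs) = concat (map enc_block ys)"
  then show "xs = ys"
  proof (induction xs arbitrary: ys)
    case Nil
    then show ?case
      by (cases ys) (auto simp: enc_block_def split: prod.splits)
  next
    case (Cons x xs)
    then show ?case
      by (cases ys) (auto simp: enc_block_def split: prod.splits)
  qed
qed

lemma dsum_simps [simp]:
  "zero (direct_sum_copies M I) = (\<lambda>i\<in>I. \<zero>\<^bsub>M\<^esub>)"
  "add (direct_sum_copies M I) t u = (\<lambda>i\<in>I. t i \<oplus>\<^bsub>M\<^esub> u i)"
  "smult (direct_sum_copies M I) a t = (\<lambda>i\<in>I. a \<odot>\<^bsub>M\<^esub> t i)"
  by (simp_all add: direct_sum_copies_def)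

lemma dsum_carrier:
  "t \<in> carrier (direct_sum_copies M I) \<longleftrightarrow>
    t \<in> extensional I \<and> (\<forall>i\<in>I. t i \<in> carrier M) \<and> finite {i \<in> I. t i \<noteq> \<zero>\<^bsub>M\<^esub>}"
  by (auto simp: direct_sum_copies_def PiE_iff)

lemma dsum_left_module:
  assumes "left_module R M" shows "left_module R (direct_sum_copies M I)"
proof -
  interpret left_module R M by fact
  let ?D = "direct_sum_copies M I"
  have restr: "(\<lambda>i\<in>I. t i) \<in> carrier ?D"
    if "\<And>i. i \<in> I \<Longrightarrow> t i \<in> carrier M" "finite F" "\<And>i. i \<in> I \<Longrightarrow> i \<notin> F \<Longrightarrow> t i = \<zero>\<^bsub>M\<^esub>" for t F
  proof -
    have "{i \<in> I. (\<lambda>i\<in>I. t i) i \<noteq> \<zero>\<^bsub>M\<^esub>} \<subseteq> F"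
      using that(3) by auto
    from finite_subset[OF this that(2)] show ?thesis
      using that(1) by (simp only: dsum_carrier) auto
  qed
  have fin: "finite {i \<in> I. x i \<noteq> \<zero>\<^bsub>M\<^esub>}" and xc: "\<And>i. i \<in> I \<Longrightarrow> x i \<in> carrier M"
    and ext: "x \<in> extensional I" if "x \<in> carrier ?D" for x
    using that by (auto simp: dsum_carrier)
  have "abelian_group ?D"
  proof (rule abelian_groupI)
    fix x assume x: "x \<in> carrier ?D"
    have "(\<lambda>i\<in>I. \<ominus>\<^bsub>M\<^esub> x i) \<in> carrier ?D"
      by (rule restr[OF _ fin[OF x]]) (use xc[OF x] in auto)
    moreover have "(\<lambda>i\<in>I. \<ominus>\<^bsub>M\<^esub> x i) \<oplus>\<^bsub>?D\<^esub> x = \<zero>\<^bsub>?D\<^esub>"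
      using xc[OF x] by (auto intro!: restrict_ext simp: M.l_neg)
    ultimately show "\<exists>y\<in>carrier ?D. y \<oplus>\<^bsub>?D\<^esub> x = \<zero>\<^bsub>?D\<^esub>"
      by blast
    have "restrict x I = x"
      by (rule extensional_restrict[OF ext[OF x]])
    moreover have "\<zero>\<^bsub>?D\<^esub> \<oplus>\<^bsub>?D\<^esub> x = restrict x I"
      using xc[OF x] by (auto intro!: restrict_ext)
    ultimately show "\<zero>\<^bsub>?D\<^esub> \<oplus>\<^bsub>?D\<^esub> x = x" by simp
  next
    fix x y assume x: "x \<in> carrier ?D" and y: "y \<in> carrier ?D"
    have "finite ({i \<in> I. x i \<noteq> \<zero>\<^bsub>M\<^esub>} \<union> {i \<in> I. y i \<noteq> \<zero>\<^bsub>M\<^esub>})"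
      using fin x y by simp
    then show "x \<oplus>\<^bsub>?D\<^esub> y \<in> carrier ?D"
      unfolding dsum_simps by (rule restr[rotated]) (use xc[OF x] xc[OF y] in auto)
    show "x \<oplus>\<^bsub>?D\<^esub> y = y \<oplus>\<^bsub>?D\<^esub> x"
      using xc[OF x] xc[OF y] by (auto intro!: restrict_ext M.a_comm)
  next
    fix x y z assume "x \<in> carrier ?D" "y \<in> carrier ?D" "z \<in> carrier ?D"
    then show "x \<oplus>\<^bsub>?D\<^esub> y \<oplus>\<^bsub>?D\<^esub> z = x \<oplus>\<^bsub>?D\<^esub> (y \<oplus>\<^bsub>?D\<^esub> z)"
      using xc by (auto intro!: restrict_ext M.a_assoc)
  next
    show "\<zero>\<^bsub>?D\<^esub> \<in> carrier ?D"
      unfolding dsum_simps by (rule restr[of _ "{}"]) auto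
  qed
  moreover have "a \<odot>\<^bsub>?D\<^esub> x \<in> carrier ?D" if "a \<in> carrier R" "x \<in> carrier ?D" for a x
    unfolding dsum_simps by (rule restr[OF _ fin[OF that(2)]]) (use xc that smult_zero_right in auto)
  moreover have "\<one>\<^bsub>R\<^esub> \<odot>\<^bsub>?D\<^esub> x = x" if x: "x \<in> carrier ?D" for x
  proof -
    have "restrict x I = x"
      by (rule extensional_restrict[OF ext[OF x]])
    moreover have "\<one>\<^bsub>R\<^esub> \<odot>\<^bsub>?D\<^esub> x = restrict x I"
      using xc[OF x] by (auto intro!: restrict_ext)
    ultimately show ?thesis by simp
  qed
  ultimately show ?thesis
    by (intro left_module.intro R.ring_axioms left_module_axioms.intro)
      (auto intro!: restrict_ext simp: xc smult_l_distr smult_r_distr smult_assoc1)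
qed

lemma submodule_image:
  assumes "left_module R X" "left_module R Y" "g \<in> lmod_hom R X Y" "submodule S R X"
  shows "submodule (g ` S) R Y"
proof (rule left_submoduleI[OF assms(2)])
  show "\<zero>\<^bsub>Y\<^esub> \<in> g ` S"
    using hom_zero[OF assms(1-3)] submoduleD(2)[OF assms(4)] by (metis imageI)
next
  fix x y assume "x \<in> g ` S" "y \<in> g ` S"
  then obtain u v where "u \<in> S" "v \<in> S" "x = g u" "y = g v" by blast
  then show "x \<oplus>\<^bsub>Y\<^esub> y \<in> g ` S"
    using homD(2)[OF assms(3), of u v] submoduleD[OF assms(4)] by (metis imageI)
next
  fix a x assume "a \<in> carrier R" "x \<in> g ` S"
  then obtain u where "u \<in> S" "x = g u" by blast
  then show "a \<odot>\<^bsub>Y\<^esub> x \<in> g ` S"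
    using homD(3)[OF assms(3), of a u] submoduleD[OF assms(4)] \<open>a \<in> carrier R\<close> by (metis imageI)
qed (use submoduleD(1)[OF assms(4)] homD(1)[OF assms(3)] in auto)

lemma shrink:
  fixes M :: "('r, 'm, 's) module_scheme" and X :: "('r, 'x, 't) module_scheme"
    and P :: "('r, 'p, 'v) module_scheme" and I :: "'i set" and c :: "'x \<Rightarrow> 'm seqs"
  assumes M: "left_module R M" and X: "left_module R X"
    and gen: "generated_by_copies R M I P"
    and e: "e \<in> lmod_hom R X P" "inj_on e (carrier X)"
    and A: "A \<subseteq> carrier X" and c: "inj_on c A"
  obtains S and \<phi> :: "'x \<Rightarrow> 'm seqs" where "submodule S R X" "A \<subseteq> S" "inj_on \<phi> S"
    "\<And>S'. submodule S' R X \<Longrightarrow> S' \<subseteq> S \<Longrightarrow> transport X S' \<phi> \<in> sigma R M"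
proof -
  interpret M: left_module R M by fact
  interpret X: left_module R X by fact
  let ?D = "direct_sum_copies M I"
  obtain \<pi> where \<pi>: "\<pi> \<in> lmod_hom R ?D P" "\<pi> ` carrier ?D = carrier P" and P: "left_module R P"
    using gen by (auto simp: generated_by_copies_def)
  have D: "left_module R ?D"
    by (rule dsum_left_module[OF M])
  define supp where "supp u = {i \<in> I. u i \<noteq> \<zero>\<^bsub>M\<^esub>}" for u :: "'i \<Rightarrow> 'm"
  have fin: "finite (supp u)" if "u \<in> carrier ?D" for u
    using that by (simp add: dsum_carrier supp_def)
  define t where "t a = inv_into (carrier ?D) \<pi> (e a)" for a
  have t: "t a \<in> carrier ?D" "\<pi> (t a) = e a" if "a \<in> A" for a
  proof -
    have "e a \<in> \<pi> ` carrier ?D"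
      using homD(1)[OF e(1), of a] A that \<pi>(2) by auto
    then show "t a \<in> carrier ?D" "\<pi> (t a) = e a"
      unfolding t_def by (rule inv_into_into, rule f_inv_into_f)
  qed
  define J where "J = (\<Union>a\<in>A. supp (t a))"
  have JI: "J \<subseteq> I"
    by (auto simp: J_def supp_def)
  obtain b where b: "\<And>i. i \<in> J \<Longrightarrow> b i \<in> A \<and> i \<in> supp (t (b i))"
    unfolding J_def by (metis UN_E)
  define k where "k i = to_nat_on (supp (t (b i))) i" for i
  have inj_J: "i = j" if "i \<in> J" "j \<in> J" "c (b i) = c (b j)" "k i = k j" for i j
  proof -
    have "b i = b j"
      using that b inj_onD[OF c] by blast
    moreover have "inj_on (to_nat_on (supp (t (b i)))) (supp (t (b i)))"
      using fin[OF t(1)] b that(1) by (intro inj_on_to_nat_on countable_finite) auto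
    ultimately show ?thesis
      using that b unfolding k_def inj_on_def by metis
  qed
  have inj_enc: "x = y" if "enc_block x = enc_block y" for x y :: "'m seqs \<times> nat \<times> 'm"
    using that by (auto simp: enc_block_def split: prod.splits)

  define D' where "D' = {u \<in> carrier ?D. supp u \<subseteq> J}"
  define Q where "Q = \<pi> ` D'"
  have D': "submodule D' R ?D"
  proof (rule left_submoduleI[OF D])
    show "\<zero>\<^bsub>?D\<^esub> \<in> D'"
      using abelian_group.axioms(1)[OF left_module.axioms(2)[OF D]] abelian_monoid.zero_closed
      by (force simp: D'_def supp_def)
  next
    fix u v assume uv: "u \<in> D'" "v \<in> D'"
    have "supp (u \<oplus>\<^bsub>?D\<^esub> v) \<subseteq> supp u \<union> supp v"
      by (auto simp: supp_def)
    moreover have "u \<oplus>\<^bsub>?D\<^esub> v \<in> carrier ?D"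
      using uv abelian_monoid.a_closed[OF abelian_group.axioms(1)[OF left_module.axioms(2)[OF D]]]
      by (simp add: D'_def del: dsum_simps)
    ultimately show "u \<oplus>\<^bsub>?D\<^esub> v \<in> D'"
      using uv unfolding D'_def by blast
  next
    fix a u assume u: "a \<in> carrier R" "u \<in> D'"
    have "supp (a \<odot>\<^bsub>?D\<^esub> u) \<subseteq> supp u"
      using M.smult_zero_right[OF u(1)] by (auto simp: supp_def)
    moreover have "a \<odot>\<^bsub>?D\<^esub> u \<in> carrier ?D"
      using u left_module.smult_closed[OF D] by (simp add: D'_def del: dsum_simps)
    ultimately show "a \<odot>\<^bsub>?D\<^esub> u \<in> D'"
      using u unfolding D'_def by blast
  qed (simp add: D'_def)
  have Q: "submodule Q R P"
    unfolding Q_def by (rule submodule_image[OF D P \<pi>(1) D'])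

  define u where "u = inv_into D' \<pi>"
  have u: "u p \<in> D'" "\<pi> (u p) = p" if "p \<in> Q" for p
    using that inv_into_into[of p \<pi> D'] f_inv_into_f[of p \<pi> D'] by (simp_all add: u_def Q_def)
  define L where "L p = (SOME xs. set xs = (\<lambda>i. (c (b i), k i, u p i)) ` supp (u p))" for p
  have L: "set (L p) = (\<lambda>i. (c (b i), k i, u p i)) ` supp (u p)" if "p \<in> Q" for p
  proof -
    have "u p \<in> carrier ?D"
      using u(1)[OF that] by (simp add: D'_def)
    then show ?thesis
      unfolding L_def by (rule someI_ex[OF finite_list[OF finite_imageI[OF fin]]])
  qed
  define code where "code p = concat (map enc_block (L p))" for p
  have inj_code: "inj_on code Q"
  proof (rule inj_onI)
    fix p q assume pq: "p \<in> Q" "q \<in> Q" "code p = code q"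
    then have "L p = L q"
      using injD[OF inj_enc_list, of "L p" "L q"] by (simp add: code_def)
    then have eq: "(\<lambda>i. (c (b i), k i, u p i)) ` supp (u p) = (\<lambda>i. (c (b i), k i, u q i)) ` supp (u q)"
      using L[OF pq(1)] L[OF pq(2)] by simp
    have sJ: "supp (u p) \<subseteq> J" "supp (u q) \<subseteq> J"
      using u(1) pq by (auto simp: D'_def)
    have 1: "u p i = u q i" if "i \<in> supp (u p)" for i
    proof -
      have "(c (b i), k i, u p i) \<in> (\<lambda>i. (c (b i), k i, u q i)) ` supp (u q)"
        using that eq by blast
      then obtain j where j: "j \<in> supp (u q)" "c (b i) = c (b j)" "k i = k j" "u p i = u q j"
        by auto
      then have "i = j"
        using inj_J that sJ by blast
      then show ?thesis using j by simp
    qed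
    have 2: "u p i = u q i" if "i \<in> supp (u q)" for i
    proof -
      have "(c (b i), k i, u q i) \<in> (\<lambda>i. (c (b i), k i, u p i)) ` supp (u p)"
        using that eq by blast
      then obtain j where j: "j \<in> supp (u p)" "c (b i) = c (b j)" "k i = k j" "u q i = u p j"
        by auto
      then have "i = j"
        using inj_J that sJ by blast
      then show ?thesis using j by simp
    qed
    have "u p i = u q i" for i
    proof (cases "i \<in> I")
      case True
      then show ?thesis
        using 1[of i] 2[of i] by (cases "u p i = \<zero>\<^bsub>M\<^esub>"; cases "u q i = \<zero>\<^bsub>M\<^esub>") (auto simp: supp_def)
    next
      case False
      then show ?thesis
        using u(1)[OF pq(1)] u(1)[OF pq(2)] by (auto simp: D'_def dsum_carrier extensional_def)
    qed
    then have "u p = u q" by (rule ext)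
    from arg_cong[OF this, of \<pi>] show "p = q"
      by (simp only: u(2)[OF pq(1)] u(2)[OF pq(2)])
  qed

  define S where "S = {x \<in> carrier X. e x \<in> Q}"
  define \<phi> where "\<phi> x = code (e x)" for x
  have S: "submodule S R X"
    unfolding S_def using homD[OF e(1)] submoduleD[OF Q] hom_zero[OF X P e(1)]
    by (intro left_submoduleI[OF X]) auto
  have AS: "A \<subseteq> S"
  proof
    fix a assume a: "a \<in> A"
    then have "t a \<in> D'"
      using t(1) by (auto simp: D'_def J_def)
    then show "a \<in> S"
      using a A imageI[of "t a" D' \<pi>] t(2)[OF a] by (auto simp: S_def Q_def)
  qed
  have inj_\<phi>: "inj_on \<phi> S"
  proof (rule inj_onI)
    fix x y assume "x \<in> S" "y \<in> S" "\<phi> x = \<phi> y"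
    then have xy: "x \<in> carrier X" "y \<in> carrier X" "e x \<in> Q" "e y \<in> Q" "code (e x) = code (e y)"
      by (simp_all add: S_def \<phi>_def)
    then show "x = y"
      using inj_onD[OF e(2) inj_onD[OF inj_code xy(5,3,4)]] by simp
  qed

  let ?P = "transport P Q code"
  note tP = transport[OF P Q inj_code]
  define \<kappa> where "\<kappa> i = enc_block (c (b i), k i, undefined :: 'm)" for i
  have inj_\<kappa>: "inj_on \<kappa> J"
  proof (rule inj_onI)
    fix i j assume ij: "i \<in> J" "j \<in> J" "\<kappa> i = \<kappa> j"
    then have "(c (b i), k i, undefined :: 'm) = (c (b j), k j, undefined)"
      unfolding \<kappa>_def by (intro inj_enc)
    then show "i = j"
      using inj_J[OF ij(1,2)] by simp
  qed
  let ?J = "\<kappa> ` J" let ?E = "direct_sum_copies M (\<kappa> ` J)"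
  define r where "r v = (\<lambda>i\<in>I. if i \<in> J then v (\<kappa> i) else \<zero>\<^bsub>M\<^esub>)" for v :: "'m seqs \<Rightarrow> 'm"
  have r: "r v \<in> D'" if v: "v \<in> carrier ?E" for v
  proof -
    have "\<kappa> ` supp (r v) \<subseteq> {j \<in> ?J. v j \<noteq> \<zero>\<^bsub>M\<^esub>}"
      by (auto simp: supp_def r_def split: if_splits)
    then have "finite (\<kappa> ` supp (r v))"
      by (rule finite_subset) (use v in \<open>simp add: dsum_carrier\<close>)
    moreover have sJ: "supp (r v) \<subseteq> J"
      by (auto simp: supp_def r_def split: if_splits)
    ultimately have "finite (supp (r v))"
      using finite_imageD inj_on_subset[OF inj_\<kappa>] by blast
    moreover have "r v \<in> extensional I" "\<forall>i\<in>I. r v i \<in> carrier M"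
      using v by (auto simp: r_def dsum_carrier)
    ultimately show ?thesis
      using sJ unfolding D'_def supp_def dsum_carrier by blast
  qed
  have rD: "r v \<in> carrier ?D" "\<pi> (r v) \<in> Q" if "v \<in> carrier ?E" for v
    using r[OF that] by (auto simp: D'_def Q_def)
  have hom: "(\<lambda>v. code (\<pi> (r v))) \<in> lmod_hom R ?E ?P"
  proof (rule homI)
    fix v w assume vw: "v \<in> carrier ?E" "w \<in> carrier ?E"
    have "r (v \<oplus>\<^bsub>?E\<^esub> w) = r v \<oplus>\<^bsub>?D\<^esub> r w"
      by (auto simp: r_def intro!: restrict_ext)
    then show "code (\<pi> (r (v \<oplus>\<^bsub>?E\<^esub> w))) = code (\<pi> (r v)) \<oplus>\<^bsub>?P\<^esub> code (\<pi> (r w))"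
      using tP(3) homD(2)[OF \<pi>(1)] rD vw by metis
  next
    fix a v assume v: "a \<in> carrier R" "v \<in> carrier ?E"
    have "r (a \<odot>\<^bsub>?E\<^esub> v) = a \<odot>\<^bsub>?D\<^esub> r v"
      using M.smult_zero_right[OF v(1)] by (auto simp: r_def intro!: restrict_ext)
    then show "code (\<pi> (r (a \<odot>\<^bsub>?E\<^esub> v))) = a \<odot>\<^bsub>?P\<^esub> code (\<pi> (r v))"
      using tP(4) homD(3)[OF \<pi>(1)] rD v by metis
  qed (use rD tP(5) in auto)
  have surj: "(\<lambda>v. code (\<pi> (r v))) ` carrier ?E = carrier ?P"
  proof
    show "(\<lambda>v. code (\<pi> (r v))) ` carrier ?E \<subseteq> carrier ?P"
      using rD tP(5) by auto
    show "carrier ?P \<subseteq> (\<lambda>v. code (\<pi> (r v))) ` carrier ?E"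
    proof
      fix x assume "x \<in> carrier ?P"
      then obtain p where p: "p \<in> Q" "x = code p"
        using tP(5) by auto
      define v where "v = (\<lambda>j\<in>?J. u p (inv_into J \<kappa> j))"
      have v\<kappa>: "v (\<kappa> i) = u p i" if "i \<in> J" for i
        using that inj_\<kappa> by (simp add: v_def)
      have upc: "u p \<in> carrier ?D" "supp (u p) \<subseteq> J"
        using u(1)[OF p(1)] by (auto simp: D'_def)
      have "r v i = u p i" for i
      proof (cases "i \<in> I")
        case True
        then show ?thesis
          using v\<kappa>[of i] upc(2) by (auto simp: r_def supp_def)
      next
        case False
        then show ?thesis
          using upc(1) by (auto simp: r_def dsum_carrier extensional_def)
      qed
      then have "r v = u p" by (rule ext)
      moreover have "v \<in> carrier ?E"
      proof -
        have "{j \<in> ?J. v j \<noteq> \<zero>\<^bsub>M\<^esub>} \<subseteq> \<kappa> ` supp (u p)"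
          using v\<kappa> JI by (auto simp: supp_def)
        then have "finite {j \<in> ?J. v j \<noteq> \<zero>\<^bsub>M\<^esub>}"
          using finite_subset fin[OF upc(1)] by blast
        moreover have "\<forall>j\<in>?J. v j \<in> carrier M"
          using v\<kappa> upc(1) JI by (auto simp: dsum_carrier)
        moreover have "v \<in> extensional ?J"
          by (simp add: v_def)
        ultimately show ?thesis
          unfolding dsum_carrier by blast
      qed
      ultimately show "x \<in> (\<lambda>v. code (\<pi> (r v))) ` carrier ?E"
        using u(2)[OF p(1)] p(2) by (intro image_eqI[of _ _ v]) auto
    qed
  qed
  have genP: "generated_by_copies R M ?J ?P"
    unfolding generated_by_copies_def using tP(1) hom surj by blast
  have "transport X S' \<phi> \<in> sigma R M" if S': "submodule S' R X" "S' \<subseteq> S" for S'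
  proof -
    note tX = transport[OF X S'(1) inj_on_subset[OF inj_\<phi> S'(2)]]
    have eS: "e x \<in> Q" "x \<in> carrier X" if "x \<in> S'" for x
      using that S'(2) by (auto simp: S_def)
    have "(\<lambda>x. x) \<in> lmod_hom R (transport X S' \<phi>) ?P"
    proof (rule homI; unfold tX(5))
      fix y z assume "y \<in> \<phi> ` S'" "z \<in> \<phi> ` S'"
      then obtain y' z' where yz: "y' \<in> S'" "z' \<in> S'" "y = \<phi> y'" "z = \<phi> z'" by blast
      then have "y \<oplus>\<^bsub>transport X S' \<phi>\<^esub> z = code (e y' \<oplus>\<^bsub>P\<^esub> e z')"
        using tX(3)[of y' z'] homD(2)[OF e(1), of y' z'] eS by (simp add: \<phi>_def)
      then show "y \<oplus>\<^bsub>transport X S' \<phi>\<^esub> z = y \<oplus>\<^bsub>?P\<^esub> z"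
        using tP(3)[of "e y'" "e z'"] eS yz by (simp add: \<phi>_def)
    next
      fix a y assume a: "a \<in> carrier R" and "y \<in> \<phi> ` S'"
      then obtain y' where yz: "y' \<in> S'" "y = \<phi> y'" by blast
      then have "a \<odot>\<^bsub>transport X S' \<phi>\<^esub> y = code (a \<odot>\<^bsub>P\<^esub> e y')"
        using tX(4)[of a y'] homD(3)[OF e(1), of a y'] eS a by (simp add: \<phi>_def)
      then show "a \<odot>\<^bsub>transport X S' \<phi>\<^esub> y = a \<odot>\<^bsub>?P\<^esub> y"
        using tP(4)[of a "e y'"] eS yz a by (simp add: \<phi>_def)
    qed (use eS tP(5) in \<open>auto simp: \<phi>_def\<close>)
    then show ?thesis
      unfolding sigma_def using tX(1) genP by (auto intro!: exI bexI[of _ "\<lambda>x. x"])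
  qed
  then show thesis
    by (rule that[OF S AS inj_\<phi>])
qed

theorem projective_in_sigma_lift:
  fixes M :: "('r, 'm, 's) module_scheme"
    and X :: "('r, 'x, 't1) module_scheme" and Y :: "('r, 'y, 't2) module_scheme"
    and P :: "('r, 'p, 't3) module_scheme" and Q :: "('r, 'q1, 't4) module_scheme"
    and I :: "'i set" and J :: "'j set"
  assumes M: "left_module R M" and proj: "projective_in_sigma R M"
    and X: "left_module R X" "generated_by_copies R M I P"
      "d \<in> lmod_hom R X P" "inj_on d (carrier X)"
    and Y: "left_module R Y" "generated_by_copies R M J Q"
      "e \<in> lmod_hom R Y Q" "inj_on e (carrier Y)"
    and g: "g \<in> lmod_hom R X Y" "g ` carrier X = carrier Y"
    and f: "f \<in> lmod_hom R M Y"
  shows "\<exists>h\<in>lmod_hom R M X. \<forall>m\<in>carrier M. g (h m) = f m"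
proof -
  define s where "s m = inv_into (carrier X) g (f m)" for m
  have s: "s m \<in> carrier X" "g (s m) = f m" if "m \<in> carrier M" for m
  proof -
    have "f m \<in> g ` carrier X"
      using homD(1)[OF f that] g(2) by simp
    then show "s m \<in> carrier X" "g (s m) = f m"
      unfolding s_def by (rule inv_into_into, rule f_inv_into_f)
  qed
  have A: "s ` carrier M \<subseteq> carrier X"
    using s by blast
  have c: "inj_on (\<lambda>x. [(inv_into (carrier M) s x, 0)]) (s ` carrier M)"
    using inv_into_injective[of "carrier M" s] by (intro inj_onI) blast
  obtain S and \<phi> :: "'x \<Rightarrow> 'm seqs" where S: "submodule S R X" "s ` carrier M \<subseteq> S"
    and \<phi>: "inj_on \<phi> S"
    and \<phi>': "\<And>S'. submodule S' R X \<Longrightarrow> S' \<subseteq> S \<Longrightarrow> transport X S' \<phi> \<in> sigma R M"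
    by (rule shrink[OF M X A c]) blast
  have gS: "submodule (g ` S) R Y"
    by (rule submodule_image[OF X(1) Y(1) g(1) S(1)])
  have A': "g ` S \<subseteq> carrier Y"
    using submoduleD(1)[OF gS] by blast
  have c': "inj_on (\<lambda>y. \<phi> (inv_into S g y)) (g ` S)"
  proof (rule inj_onI)
    fix y z assume yz: "y \<in> g ` S" "z \<in> g ` S" "\<phi> (inv_into S g y) = \<phi> (inv_into S g z)"
    then have "inv_into S g y = inv_into S g z"
      using inj_onD[OF \<phi> yz(3) inv_into_into[OF yz(1)] inv_into_into[OF yz(2)]] by simp
    then show "y = z"
      using f_inv_into_f[OF yz(1)] f_inv_into_f[OF yz(2)] by metis
  qed
  obtain T and \<psi> :: "'y \<Rightarrow> 'm seqs" where T: "g ` S \<subseteq> T" "inj_on \<psi> T"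
    and \<psi>': "\<And>S'. submodule S' R Y \<Longrightarrow> S' \<subseteq> T \<Longrightarrow> transport Y S' \<psi> \<in> sigma R M"
    by (rule shrink[OF M Y A' c']) blast
  have \<psi>: "inj_on \<psi> (g ` S)"
    using inj_on_subset[OF T(2) T(1)] .
  let ?X = "transport X S \<phi>" and ?Y = "transport Y (g ` S) \<psi>"
  note tX = transport[OF X(1) S(1) \<phi>] and tY = transport[OF Y(1) gS \<psi>]
  let ?g = "\<lambda>w. \<psi> (g (inv_into S \<phi> w))"
  have SX: "x \<in> carrier X" if "x \<in> S" for x
    using submoduleD(1)[OF S(1) that] .
  have inv: "inv_into S \<phi> w \<in> S" if "w \<in> carrier ?X" for w
    using that tX(5) by (auto intro: inv_into_into)
  have hg: "?g \<in> lmod_hom R ?X ?Y"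
  proof (rule homI)
    fix v w assume vw: "v \<in> carrier ?X" "w \<in> carrier ?X"
    show "?g (v \<oplus>\<^bsub>?X\<^esub> w) = ?g v \<oplus>\<^bsub>?Y\<^esub> ?g w"
      unfolding homD(2)[OF tX(2) vw] homD(2)[OF g(1) SX[OF inv[OF vw(1)]] SX[OF inv[OF vw(2)]]]
      by (intro tY(3) imageI inv vw)
  next
    fix a v assume v: "a \<in> carrier R" "v \<in> carrier ?X"
    show "?g (a \<odot>\<^bsub>?X\<^esub> v) = a \<odot>\<^bsub>?Y\<^esub> ?g v"
      unfolding homD(3)[OF tX(2) v] homD(3)[OF g(1) v(1) SX[OF inv[OF v(2)]]]
      by (intro tY(4) imageI inv v)
  qed (use inv tY(5) in auto)
  have surj: "?g ` carrier ?X = carrier ?Y"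
    unfolding tX(5) tY(5) image_image using \<phi> by (intro image_cong) simp_all
  have fS: "f m \<in> g ` S" if "m \<in> carrier M" for m
    using s(2)[OF that] imageI[of "s m" S g] S(2) that by auto
  have hf: "(\<lambda>m. \<psi> (f m)) \<in> lmod_hom R M ?Y"
    using homD[OF f] fS tY(3,4,5) by (intro homI) auto
  obtain h where h: "h \<in> lmod_hom R M ?X" "\<forall>m\<in>carrier M. ?g (h m) = \<psi> (f m)"
    using proj[unfolded projective_in_sigma_def, rule_format,
        OF \<phi>'[OF S(1) order_refl] \<psi>'[OF gS T(1)] hg surj hf] by (elim bexE) auto
  let ?h = "\<lambda>m. inv_into S \<phi> (h m)"
  have "?h \<in> lmod_hom R M X"
    using homD[OF h(1)] homD[OF tX(2)] by (intro homI) auto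
  moreover have "g (?h m) = f m" if "m \<in> carrier M" for m
  proof (rule inj_onD[OF \<psi>])
    show "\<psi> (g (?h m)) = \<psi> (f m)"
      using h(2) that by blast
    show "g (?h m) \<in> g ` S"
      using inv[OF homD(1)[OF h(1) that]] by (rule imageI)
  qed (rule fS[OF that])
  ultimately show ?thesis
    by (intro bexI[of _ ?h] ballI)
qed

end

theory Submission
  imports Defs
begin

text \<open>Since \<open>M\<close> is projective, lifting a map \<open>M \<rightarrow> \<Sum>\<^sub>i g\<^sub>i(K\<^sub>i)\<close> to the direct sum of the
  \<open>K\<^sub>i\<close> shows that a set killed by all maps from \<open>M\<close> to each \<open>K\<^sub>i\<close> is killed by all
  maps to the sum; hence \<open>r(N) = Ler(N)\<close>. The hypothesis says that every annihilator lies in \<open>\<Psi>(M)\<close>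
  and gives \<open>Ler(0) = 0\<close>. Together these exclude nonzero \<open>Z\<close> with \<open>Z \<subseteq> Ann(Z)\<close>, so that
  \<open>Y \<subseteq> Ann(X)\<close> becomes symmetric in \<open>X\<close> and \<open>Y\<close>. If \<open>N + Ann(Rm) = M\<close>, then the
  identity of \<open>M\<close> splits as \<open>p + q\<close> with \<open>p\<close> mapping to \<open>N\<close> and \<open>q\<close> to \<open>Ann(Rm)\<close>, and
  \<open>q(m) = 0\<close> by symmetry; hence \<open>Ler(N) \<subseteq> N\<close> and \<open>\<Psi>(M)\<close> is the first stage \<open>A\<^sup>r\<close>.
  The double annihilator of \<open>Rm\<close> contains \<open>m\<close>, lies in \<open>\<Psi>(M)\<close> and has the annihilator of
  \<open>Rm\<close>, so forming \<open>r\<close> inside \<open>\<Psi>(M)\<close> changes nothing and the chain stops there.\<close>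

section \<open>The core of a chain that stops after one step\<close>

text \<open>By transfinite induction \<open>P\<close> lies in every stage, and every stage other
  than the zeroth lies in \<open>P\<close>. So only \<open>carrier A\<close> and \<open>P\<close>
  occur as stages.\<close>

lemma regular_core_eqI:
  assumes 1: "r_fixed A = P" and 2: "r_fixed (A\<lparr>carrier := P\<rparr>) = P"
  shows "regular_core A = P"
proof -
  define \<rho> where "\<rho> = cardSuc (card_of (carrier A))"
  interpret wo_rel \<rho>
    unfolding \<rho>_def by (rule wo_rel_cardSuc)
  note wo = wo_rel_axioms
  have PA: "P \<subseteq> carrier A"
    using 1 by (auto simp: r_fixed_def)
  have zero: "r_stage A \<rho> i = carrier A" if "underS i = {}" for i
    by (rule r_stage_zero[OF wo that])
  have upper: "r_stage A \<rho> i \<subseteq> P" if "underS i \<noteq> {}" for i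
  proof -
    have F: "underS i \<subseteq> Field \<rho>"
      by (auto simp: underS_def intro: FieldI1)
    \<comment> \<open>The least element below \<open>i\<close> has nothing below itself, so its
      stage is \<open>carrier A\<close>. The chain decreases, which puts stage \<open>i\<close>
      inside \<open>r_fixed A\<close>.\<close>
    define z where "z = minim (underS i)"
    have z: "z \<in> underS i" "\<And>k. k \<in> underS i \<Longrightarrow> (z, k) \<in> \<rho>"
      unfolding z_def using minim_in[OF F that] minim_least[OF F] by auto
    have "k \<in> underS i" if "k \<in> underS z" for k
      using that z(1) TRANS ANTISYM unfolding underS_def
      by (auto dest: transD antisymD)
    then have "underS z = {}"
      using z(2) ANTISYM unfolding underS_def by (auto dest: antisymD)
    from r_stage_decreasing[OF wo z(1), of A] zero[OF this] 1 show ?thesis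
      by simp
  qed
  have lower: "P \<subseteq> r_stage A \<rho> i" for i
  proof (induction i rule: well_order_induct)
    case (1 i)
    then have IH: "P \<subseteq> r_stage A \<rho> j" if "j \<in> underS i" for j
      using that by (auto simp: underS_def)
    show ?case
    proof (cases "underS i = {}")
      case True
      then show ?thesis
        using zero PA by simp
    next
      case ne: False
      show ?thesis
      proof (cases "\<exists>j. underS i = under j")
        case True
        then obtain j where j: "underS i = under j" by blast
        \<comment> \<open>The two assumptions say what the next stage is in these two cases; it is
          \<open>P\<close> in both.\<close>
        have "r_stage A \<rho> j = carrier A \<or> r_stage A \<rho> j = P"
          using zero upper IH[OF the_pred(2)[OF wo ne j]] by blast
        then show ?thesis
          using r_stage_suc[OF wo ne j, of A] \<open>r_fixed A = P\<close> 2 by auto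
      next
        case False
        then show ?thesis
          using r_stage_limit[OF wo ne False, of A] IH by auto
      qed
    qed
  qed
  define E where "E = {i \<in> Field \<rho>. r_fixed (A\<lparr>carrier := r_stage A \<rho> i\<rparr>) = r_stage A \<rho> i}"
  have "E \<subseteq> Field \<rho>" "E \<noteq> {}"
    using r_stage_stabilizes[of A] by (auto simp: E_def \<rho>_def)
  then have "minim E \<in> E"
    by (rule minim_in)
  moreover have "regular_core A = r_stage A \<rho> (minim E)"
    by (simp add: regular_core_def r_infinity_def E_def \<rho>_def Let_def)
  \<comment> \<open>If the zeroth stage is already stable, then
    \<open>carrier A = r_fixed A = P\<close>; otherwise the bounds \<open>upper\<close> and
    \<open>lower\<close> meet.\<close>
  ultimately show ?thesis
    using zero[of "minim E"] upper[of "minim E"] lower[of "minim E"] 1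
    by (cases "underS (minim E) = {}") (auto simp: E_def)
qed

section \<open>Suprema, bottom and top in families of sets ordered by inclusion\<close>

text \<open>Serves the whole of \<open>fi_quantale R M\<close> and also its restrictions to smaller
  carriers, where suprema, bottom and top have to be taken inside the smaller carrier.\<close>

locale set_order =
  fixes A :: "('a set, 'c) quantale_scheme"
  assumes eq: "eq A = (=)" and le: "le A = (\<subseteq>)"
begin

text \<open>Suprema are chosen by \<open>SOME\<close>; antisymmetry of inclusion leaves a single
  candidate.\<close>

lemma least_eqI: "least A s U \<Longrightarrow> (SOME x. least A x U) = s"
  by (rule some_equality) (auto simp: least_def le)

lemma sup_eqI:
  assumes "s \<in> carrier A" "\<And>x. x \<in> F \<Longrightarrow> x \<subseteq> s" "F \<subseteq> carrier A"
    and "\<And>u. u \<in> carrier A \<Longrightarrow> (\<And>x. x \<in> F \<Longrightarrow> x \<subseteq> u) \<Longrightarrow> s \<subseteq> u"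
  shows "\<Squnion>\<^bsub>A\<^esub>F = s"
  unfolding sup_def
proof (rule least_eqI)
  show "least A s (Upper A F)"
    unfolding least_def
  proof (intro conjI ballI)
    fix u assume "u \<in> Upper A F"
    then have "u \<in> carrier A" "\<And>x. x \<in> F \<Longrightarrow> x \<subseteq> u"
      using assms(3) by (auto simp: Upper_def le)
    then show "s \<sqsubseteq>\<^bsub>A\<^esub> u"
      using assms(4) by (simp add: le)
  qed (use assms(1-3) in \<open>auto simp: Upper_def le\<close>)
qed

lemma bot_eqI: "s \<in> carrier A \<Longrightarrow> (\<And>u. u \<in> carrier A \<Longrightarrow> s \<subseteq> u) \<Longrightarrow> \<bottom>\<^bsub>A\<^esub> = s"
  unfolding bottom_def by (rule some_equality) (auto simp: least_def le)

lemma top_eqI: "s \<in> carrier A \<Longrightarrow> (\<And>u. u \<in> carrier A \<Longrightarrow> u \<subseteq> s) \<Longrightarrow> \<top>\<^bsub>A\<^esub> = s"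
  unfolding top_def by (rule some_equality) (auto simp: greatest_def le)

end


section \<open>Submodules as modules, and lifting to direct sums\<close>

context left_module
begin

abbreviation sub_mod :: "'m set \<Rightarrow> ('r, 'm, 's) module_scheme"
  where "sub_mod K \<equiv> M\<lparr>carrier := K\<rparr>"

abbreviation endos :: "('m \<Rightarrow> 'm) set"
  where "endos \<equiv> lmod_hom R M M"

abbreviation ann :: "'m set \<Rightarrow> 'm set"
  where "ann K \<equiv> Ann R M (sub_mod K)"

lemma left_module_sub_mod:
  assumes "submodule K R X" "left_module R X"
  shows "left_module R (X\<lparr>carrier := K\<rparr>)"
proof -
  interpret X: left_module R X by fact
  note K = submoduleD[OF assms(1)]
  have "abelian_group (X\<lparr>carrier := K\<rparr>)"
  proof (rule abelian_groupI)
    fix x assume "x \<in> carrier (X\<lparr>carrier := K\<rparr>)"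
    then show "\<exists>y\<in>carrier (X\<lparr>carrier := K\<rparr>). y \<oplus>\<^bsub>X\<lparr>carrier := K\<rparr>\<^esub> x = \<zero>\<^bsub>X\<lparr>carrier := K\<rparr>\<^esub>"
      using K by (intro bexI[of _ "\<ominus>\<^bsub>X\<^esub> x"]) (auto simp: X.M.l_neg)
  qed (use K in \<open>auto simp: X.M.a_assoc intro: X.M.a_comm\<close>)
  then show ?thesis
    using K by (intro left_module.intro R.ring_axioms left_module_axioms.intro)
      (auto simp: X.smult_l_distr X.smult_r_distr X.smult_assoc1)
qed

lemma hom_sub_mod_iff:
  "K \<subseteq> carrier M \<Longrightarrow> f \<in> lmod_hom R M (sub_mod K) \<longleftrightarrow> f \<in> endos \<and> f ` carrier M \<subseteq> K"
  by (auto simp: lmod_hom_def)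

text \<open>\<open>M\<close> is a direct sum of one copy of itself, so its submodules belong to
  \<open>\<sigma>[M]\<close>.\<close>

lemma generated_by_self: "generated_by_copies R M {()} M"
proof -
  have "(\<lambda>t. t ()) \<in> lmod_hom R (direct_sum_copies M {()}) M"
    by (rule homI) (auto simp: dsum_carrier)
  moreover have "(\<lambda>t. t ()) ` carrier (direct_sum_copies M {()}) = carrier M"
  proof
    show "carrier M \<subseteq> (\<lambda>t. t ()) ` carrier (direct_sum_copies M {()})"
    proof
      fix m assume "m \<in> carrier M"
      then have "(\<lambda>i\<in>{()}. m) \<in> carrier (direct_sum_copies M {()})"
        by (simp only: dsum_carrier) auto
      then show "m \<in> (\<lambda>t. t ()) ` carrier (direct_sum_copies M {()})"
        by (intro image_eqI[of _ _ "\<lambda>i\<in>{()}. m"]) simp_all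
    qed
  qed (auto simp: dsum_carrier)
  ultimately show ?thesis
    unfolding generated_by_copies_def using left_module_axioms by blast
qed

lemma generated_by_dsum: "generated_by_copies R M I (direct_sum_copies M I)"
  unfolding generated_by_copies_def using dsum_left_module[OF left_module_axioms]
  by (auto intro!: bexI[of _ "\<lambda>t. t"] homI simp del: dsum_simps)

lemma smult_finsum:
  assumes "a \<in> carrier R" "finite F" "f \<in> F \<rightarrow> carrier M"
  shows "a \<odot>\<^bsub>M\<^esub> finsum M f F = (\<Oplus>\<^bsub>M\<^esub>i\<in>F. a \<odot>\<^bsub>M\<^esub> f i)"
  using assms(2,3)
proof (induction F rule: finite_induct)
  case empty
  then show ?case
    using smult_zero_right[OF assms(1)] by simp
next
  case (insert i F)
  then have "f i \<in> carrier M" "f \<in> F \<rightarrow> carrier M"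
    by auto
  moreover have "(\<lambda>i. a \<odot>\<^bsub>M\<^esub> f i) \<in> F \<rightarrow> carrier M"
    using calculation assms(1) by auto
  ultimately show ?case
    using insert.hyps insert.IH assms(1) by (simp add: smult_r_distr)
qed

text \<open>\<open>W\<close> is the sum of the images \<open>g i (K i)\<close>, a quotient of the
  direct sum of the \<open>K i\<close>. A map from \<open>M\<close> to \<open>W\<close> lifts to
  that direct sum, and the \<open>h i\<close> are the coordinates of the lift. The index set
  \<open>F\<close> may be any finite set containing the support, so that an application can choose a
  convenient one.\<close>

lemma projective_lift_sum:
  fixes I :: "'i set"
  assumes proj: "projective_in_sigma R M"
    and K: "\<And>i. i \<in> I \<Longrightarrow> submodule (K i) R M" and g: "\<And>i. i \<in> I \<Longrightarrow> g i \<in> endos"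
  obtains W where "submodule W R M" "\<And>i x. i \<in> I \<Longrightarrow> x \<in> K i \<Longrightarrow> g i x \<in> W"
    "\<And>f. f \<in> endos \<Longrightarrow> f ` carrier M \<subseteq> W \<Longrightarrow>
      \<exists>h. (\<forall>i\<in>I. h i \<in> lmod_hom R M (sub_mod (K i))) \<and>
        (\<forall>m\<in>carrier M. \<forall>F. finite F \<longrightarrow> F \<subseteq> I \<longrightarrow> {i \<in> I. h i m \<noteq> \<zero>\<^bsub>M\<^esub>} \<subseteq> F \<longrightarrow>
          f m = (\<Oplus>\<^bsub>M\<^esub>i\<in>F. g i (h i m)))"
proof -
  let ?D = "direct_sum_copies M I"
  note D = dsum_left_module[OF left_module_axioms, of I]
  interpret D: left_module R ?D by (rule D)
  have KM: "x \<in> carrier M" if "i \<in> I" "x \<in> K i" for i x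
    using submoduleD(1)[OF K[OF that(1)] that(2)] .
  have gM: "g i x \<in> carrier M" if "i \<in> I" "x \<in> carrier M" for i x
    using homD(1)[OF g[OF that(1)] that(2)] .
  define supp where "supp t = {i \<in> I. t i \<noteq> \<zero>\<^bsub>M\<^esub>}" for t
  define p where "p t = (\<Oplus>\<^bsub>M\<^esub>i\<in>supp t. g i (t i))" for t
  \<comment> \<open>Indices outside the support contribute \<open>g i\<close> of zero. This allows
    \<open>p t\<close>, \<open>p u\<close> and the value of \<open>p\<close> at their sum to be
    written over one index set.\<close>
  have p_eq: "p t = (\<Oplus>\<^bsub>M\<^esub>i\<in>F. g i (t i))"
    if "\<And>i. i \<in> I \<Longrightarrow> t i \<in> carrier M" "finite F" "F \<subseteq> I" "supp t \<subseteq> F" for t F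
    unfolding p_def
  proof (rule M.add.finprod_mono_neutral_cong_left)
    fix i assume "i \<in> F - supp t"
    then have "i \<in> I" "t i = \<zero>\<^bsub>M\<^esub>"
      using that by (auto simp: supp_def)
    then show "g i (t i) = \<zero>\<^bsub>M\<^esub>"
      using hom_zero[OF left_module_axioms left_module_axioms g] by simp
  qed (use that gM in auto)
  have cD: "\<And>i. i \<in> I \<Longrightarrow> t i \<in> carrier M" "finite (supp t)" "supp t \<subseteq> I" if "t \<in> carrier ?D" for t
    using that by (auto simp: dsum_carrier supp_def)
  have p: "p \<in> lmod_hom R ?D M"
  proof (rule homI)
    fix t assume t: "t \<in> carrier ?D"
    show "p t \<in> carrier M"
      unfolding p_def using cD[OF t] gM by (intro M.finsum_closed) auto
  next
    fix t u assume t: "t \<in> carrier ?D" and u: "u \<in> carrier ?D"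
    have tu: "t \<oplus>\<^bsub>?D\<^esub> u \<in> carrier ?D"
      by (rule D.M.a_closed[OF t u])
    have val: "(t \<oplus>\<^bsub>?D\<^esub> u) i = t i \<oplus>\<^bsub>M\<^esub> u i" if "i \<in> I" for i
      using that by simp
    let ?F = "supp t \<union> supp u"
    have F: "finite ?F" "?F \<subseteq> I"
      using cD[OF t] cD[OF u] by auto
    have "supp (t \<oplus>\<^bsub>?D\<^esub> u) \<subseteq> ?F"
      by (auto simp: supp_def)
    from p_eq[OF cD(1)[OF tu] F this]
    have "p (t \<oplus>\<^bsub>?D\<^esub> u) = (\<Oplus>\<^bsub>M\<^esub>i\<in>?F. g i ((t \<oplus>\<^bsub>?D\<^esub> u) i))" .
    also have "\<dots> = (\<Oplus>\<^bsub>M\<^esub>i\<in>?F. g i (t i) \<oplus>\<^bsub>M\<^esub> g i (u i))"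
      using F val cD(1)[OF t] cD(1)[OF u] gM homD(2)[OF g]
      by (intro M.finsum_cong') (auto simp: subset_iff)
    also have "\<dots> = (\<Oplus>\<^bsub>M\<^esub>i\<in>?F. g i (t i)) \<oplus>\<^bsub>M\<^esub> (\<Oplus>\<^bsub>M\<^esub>i\<in>?F. g i (u i))"
      using F cD(1)[OF t] cD(1)[OF u] gM by (intro M.finsum_addf) auto
    also have "\<dots> = p t \<oplus>\<^bsub>M\<^esub> p u"
      using p_eq[OF cD(1)[OF t] F] p_eq[OF cD(1)[OF u] F] by simp
    finally show "p (t \<oplus>\<^bsub>?D\<^esub> u) = p t \<oplus>\<^bsub>M\<^esub> p u" .
  next
    fix a t assume a: "a \<in> carrier R" and t: "t \<in> carrier ?D"
    have at: "a \<odot>\<^bsub>?D\<^esub> t \<in> carrier ?D"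
      by (rule D.smult_closed[OF a t])
    have val: "(a \<odot>\<^bsub>?D\<^esub> t) i = a \<odot>\<^bsub>M\<^esub> t i" if "i \<in> I" for i
      using that by simp
    have "supp (a \<odot>\<^bsub>?D\<^esub> t) \<subseteq> supp t"
      using smult_zero_right[OF a] by (auto simp: supp_def)
    from p_eq[OF cD(1)[OF at] cD(2,3)[OF t] this]
    have "p (a \<odot>\<^bsub>?D\<^esub> t) = (\<Oplus>\<^bsub>M\<^esub>i\<in>supp t. g i ((a \<odot>\<^bsub>?D\<^esub> t) i))" .
    also have "\<dots> = (\<Oplus>\<^bsub>M\<^esub>i\<in>supp t. a \<odot>\<^bsub>M\<^esub> g i (t i))"
      using a val cD[OF t] gM homD(3)[OF g]
      by (intro M.finsum_cong') (auto simp: subset_iff)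
    also have "\<dots> = a \<odot>\<^bsub>M\<^esub> p t"
      unfolding p_def using cD[OF t] gM by (intro smult_finsum[OF a, symmetric]) auto
    finally show "p (a \<odot>\<^bsub>?D\<^esub> t) = a \<odot>\<^bsub>M\<^esub> p t" .
  qed
  \<comment> \<open>The direct sum of the \<open>K i\<close>, inside the direct sum of copies of
    \<open>M\<close>.\<close>
  define X where "X = {t \<in> carrier ?D. \<forall>i\<in>I. t i \<in> K i}"
  have X: "submodule X R ?D"
  proof (rule left_submoduleI[OF D])
    show "\<zero>\<^bsub>?D\<^esub> \<in> X"
      using D.M.zero_closed submoduleD(2)[OF K] by (simp add: X_def)
  next
    fix t u assume "t \<in> X" "u \<in> X"
    then show "t \<oplus>\<^bsub>?D\<^esub> u \<in> X"
      using D.M.a_closed[of t u] submoduleD(3)[OF K] by (simp add: X_def)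
  next
    fix a t assume "a \<in> carrier R" "t \<in> X"
    then show "a \<odot>\<^bsub>?D\<^esub> t \<in> X"
      using D.smult_closed[of a t] submoduleD(5)[OF K] by (simp add: X_def)
  qed (simp add: X_def)
  let ?X = "?D\<lparr>carrier := X\<rparr>" and ?W = "p ` X"
  have W: "submodule ?W R M"
    by (rule submodule_image[OF D left_module_axioms p X])
  have XD: "X \<subseteq> carrier ?D"
    by (auto simp: X_def)
  show thesis
  proof (rule that[OF W])
    fix i x assume i: "i \<in> I" and x: "x \<in> K i"
    define t where "t = (\<lambda>j\<in>I. if j = i then x else \<zero>\<^bsub>M\<^esub>)"
    have s: "supp t \<subseteq> {i}"
      by (auto simp: supp_def t_def)
    have "finite (supp t)"
      by (rule finite_subset[OF s]) simp
    moreover have ti: "\<forall>j\<in>I. t j \<in> K j"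
      using x submoduleD(2)[OF K] by (auto simp: t_def)
    ultimately have "t \<in> X"
      using KM unfolding X_def dsum_carrier supp_def by (auto simp: t_def)
    moreover have "p t = g i x"
      using p_eq[of t "{i}", OF _ _ _ s] i x ti KM gM by (auto simp: t_def)
    ultimately show "g i x \<in> ?W"
      by (metis imageI)
  next
    fix f assume f: "f \<in> endos" "f ` carrier M \<subseteq> ?W"
    have WM: "?W \<subseteq> carrier M"
      using submoduleD(1)[OF W] by auto
    have "\<exists>h\<in>lmod_hom R M ?X. \<forall>m\<in>carrier M. p (h m) = f m"
    proof (rule projective_in_sigma_lift[OF left_module_axioms proj])
      show "left_module R ?X"
        by (rule left_module_sub_mod[OF X D])
      show "generated_by_copies R M I ?D"
        by (rule generated_by_dsum)
      show "(\<lambda>t. t) \<in> lmod_hom R ?X ?D"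
        using XD by (intro homI) auto
      show "left_module R (sub_mod ?W)"
        by (rule left_module_sub_mod[OF W left_module_axioms])
      show "generated_by_copies R M {()} M"
        by (rule generated_by_self)
      show "(\<lambda>t. t) \<in> lmod_hom R (sub_mod ?W) M"
        using WM by (intro homI) auto
      show "p \<in> lmod_hom R ?X (sub_mod ?W)"
        using homD[OF p] subsetD[OF XD] by (intro homI) (auto simp del: dsum_simps)
      show "f \<in> lmod_hom R M (sub_mod ?W)"
        using f hom_sub_mod_iff[OF WM] by blast
    qed auto
    then obtain h where h: "h \<in> lmod_hom R M ?X" and fh: "\<And>m. m \<in> carrier M \<Longrightarrow> p (h m) = f m"
      by blast
    have hX: "h m \<in> X" if "m \<in> carrier M" for m
      using homD(1)[OF h that] by simp
    show "\<exists>h. (\<forall>i\<in>I. h i \<in> lmod_hom R M (sub_mod (K i))) \<and>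
        (\<forall>m\<in>carrier M. \<forall>F. finite F \<longrightarrow> F \<subseteq> I \<longrightarrow> {i \<in> I. h i m \<noteq> \<zero>\<^bsub>M\<^esub>} \<subseteq> F \<longrightarrow>
          f m = (\<Oplus>\<^bsub>M\<^esub>i\<in>F. g i (h i m)))"
    proof (intro exI[of _ "\<lambda>i m. h m i"] conjI ballI allI impI)
      fix i assume i: "i \<in> I"
      show "(\<lambda>m. h m i) \<in> lmod_hom R M (sub_mod (K i))"
        using homD(2,3)[OF h] i hX by (intro homI) (auto simp: X_def)
    next
      fix m F assume "m \<in> carrier M" "finite F" "F \<subseteq> I" "{i \<in> I. h m i \<noteq> \<zero>\<^bsub>M\<^esub>} \<subseteq> F"
      then show "f m = (\<Oplus>\<^bsub>M\<^esub>i\<in>F. g i (h m i))"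
        using p_eq[of "h m" F] fh[of m] hX[of m] cD(1)[of "h m"] by (simp add: X_def supp_def)
    qed
  qed
qed


section \<open>Annihilators, sums and intersections of fully invariant submodules\<close>

lemma ann_iff:
  "K \<subseteq> carrier M \<Longrightarrow> m \<in> ann K \<longleftrightarrow>
    m \<in> carrier M \<and> (\<forall>f\<in>endos. f ` carrier M \<subseteq> K \<longrightarrow> f m = \<zero>\<^bsub>M\<^esub>)"
  by (auto simp: Ann_def hom_sub_mod_iff)

lemma ann_antimono: "L \<subseteq> K \<Longrightarrow> K \<subseteq> carrier M \<Longrightarrow> ann K \<subseteq> ann L"
  by (auto simp: ann_iff)

lemma fully_invariantD:
  assumes "N \<in> fully_invariant R M"
  shows "submodule N R M" "N \<subseteq> carrier M" "\<And>f x. f \<in> endos \<Longrightarrow> x \<in> N \<Longrightarrow> f x \<in> N"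
  using assms submoduleD(1)[of N R M] by (auto simp: fully_invariant_def)

lemma endos_comp: "f \<in> endos \<Longrightarrow> g \<in> endos \<Longrightarrow> (\<lambda>x. f (g x)) \<in> endos"
  by (rule homI) (auto simp: homD)

lemma endos_ident: "(\<lambda>x. x) \<in> endos"
  by (rule homI) auto

lemma endos_zero: "f \<in> endos \<Longrightarrow> f \<zero>\<^bsub>M\<^esub> = \<zero>\<^bsub>M\<^esub>"
  using hom_zero left_module_axioms by blast

text \<open>Composing a map from \<open>M\<close> to \<open>K\<close> with an endomorphism of
  \<open>M\<close> gives another map from \<open>M\<close> to \<open>K\<close>.\<close>

lemma ann_fully_invariant:
  assumes "K \<subseteq> carrier M"
  shows "ann K \<in> fully_invariant R M"
proof -
  have "submodule (ann K) R M"
    by (rule left_submoduleI[OF left_module_axioms])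
      (auto simp: ann_iff[OF assms] endos_zero homD smult_zero_right)
  moreover have "g m \<in> ann K" if g: "g \<in> endos" and m: "m \<in> ann K" for g m
  proof -
    have "f (g m) = \<zero>\<^bsub>M\<^esub>" if f: "f \<in> endos" "f ` carrier M \<subseteq> K" for f
    proof -
      have "(\<lambda>x. f (g x)) ` carrier M \<subseteq> K"
        using f(2) homD(1)[OF g] by auto
      then show ?thesis
        using m endos_comp[OF f(1) g] by (auto simp: ann_iff[OF assms])
    qed
    then show ?thesis
      using m homD(1)[OF g] by (auto simp: ann_iff[OF assms])
  qed
  ultimately show ?thesis
    by (auto simp: fully_invariant_def)
qed

lemma ann_zero: "ann {\<zero>\<^bsub>M\<^esub>} = carrier M"
  by (auto simp: ann_iff image_subset_iff)

lemma ann_self: "Ann R M M = {\<zero>\<^bsub>M\<^esub>}"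
  using endos_ident by (auto simp: Ann_def endos_zero)

lemma ann_carrier: "ann (carrier M) = {\<zero>\<^bsub>M\<^esub>}"
  by (simp add: ann_self)

lemma zero_fully_invariant: "{\<zero>\<^bsub>M\<^esub>} \<in> fully_invariant R M"
  using ann_fully_invariant[OF order_refl] by (simp add: ann_self)

lemma carrier_fully_invariant: "carrier M \<in> fully_invariant R M"
  using ann_fully_invariant[of "{\<zero>\<^bsub>M\<^esub>}"] by (simp add: ann_zero)

lemma Int_fully_invariant:
  assumes N: "N \<in> fully_invariant R M" and L: "L \<in> fully_invariant R M"
  shows "N \<inter> L \<in> fully_invariant R M"
proof -
  note n = fully_invariantD[OF N] and l = fully_invariantD[OF L]
  have "submodule (N \<inter> L) R M"
    by (rule left_submoduleI[OF left_module_axioms])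
      (use submoduleD[OF n(1)] submoduleD[OF l(1)] in auto)
  then show ?thesis
    using n(3) l(3) by (auto simp: fully_invariant_def)
qed

lemma mem_set_add: "x \<in> N <+>\<^bsub>M\<^esub> L \<longleftrightarrow> (\<exists>n\<in>N. \<exists>l\<in>L. x = n \<oplus>\<^bsub>M\<^esub> l)"
  by (auto simp: set_add_def')

lemma add_fully_invariant:
  assumes N: "N \<in> fully_invariant R M" and L: "L \<in> fully_invariant R M"
  shows "N <+>\<^bsub>M\<^esub> L \<in> fully_invariant R M"
proof -
  note n = fully_invariantD[OF N] and l = fully_invariantD[OF L]
  note nD = submoduleD[OF n(1)] and lD = submoduleD[OF l(1)]
  have "submodule (N <+>\<^bsub>M\<^esub> L) R M"
  proof (rule left_submoduleI[OF left_module_axioms])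
    show "\<zero>\<^bsub>M\<^esub> \<in> N <+>\<^bsub>M\<^esub> L"
      using nD(2) lD(2) M.r_zero[OF M.zero_closed] unfolding mem_set_add by metis
  next
    fix x y assume "x \<in> N <+>\<^bsub>M\<^esub> L" "y \<in> N <+>\<^bsub>M\<^esub> L"
    then obtain a b c d where *: "a \<in> N" "b \<in> L" "c \<in> N" "d \<in> L" "x = a \<oplus>\<^bsub>M\<^esub> b" "y = c \<oplus>\<^bsub>M\<^esub> d"
      unfolding mem_set_add by blast
    then have "x \<oplus>\<^bsub>M\<^esub> y = (a \<oplus>\<^bsub>M\<^esub> c) \<oplus>\<^bsub>M\<^esub> (b \<oplus>\<^bsub>M\<^esub> d)"
      using nD(1) lD(1) by (simp add: M.a_ac)
    then show "x \<oplus>\<^bsub>M\<^esub> y \<in> N <+>\<^bsub>M\<^esub> L"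
      unfolding mem_set_add using * nD(3) lD(3) by blast
  next
    fix a x assume a: "a \<in> carrier R" and "x \<in> N <+>\<^bsub>M\<^esub> L"
    then obtain b c where *: "b \<in> N" "c \<in> L" "x = b \<oplus>\<^bsub>M\<^esub> c"
      unfolding mem_set_add by blast
    then have "a \<odot>\<^bsub>M\<^esub> x = a \<odot>\<^bsub>M\<^esub> b \<oplus>\<^bsub>M\<^esub> a \<odot>\<^bsub>M\<^esub> c"
      using nD(1) lD(1) a by (simp add: smult_r_distr)
    then show "a \<odot>\<^bsub>M\<^esub> x \<in> N <+>\<^bsub>M\<^esub> L"
      unfolding mem_set_add using * nD(5) lD(5) a by blast
  qed (use nD(1) lD(1) in \<open>auto simp: mem_set_add\<close>)
  moreover have "f x \<in> N <+>\<^bsub>M\<^esub> L" if f: "f \<in> endos" and x: "x \<in> N <+>\<^bsub>M\<^esub> L" for f x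
  proof -
    obtain b c where *: "b \<in> N" "c \<in> L" "x = b \<oplus>\<^bsub>M\<^esub> c"
      using x unfolding mem_set_add by blast
    then have "f x = f b \<oplus>\<^bsub>M\<^esub> f c"
      using nD(1) lD(1) homD(2)[OF f] by simp
    then show ?thesis
      unfolding mem_set_add using * n(3) l(3) f by blast
  qed
  ultimately show ?thesis
    by (auto simp: fully_invariant_def)
qed

lemma set_add_subset:
  assumes "submodule U R M" "N \<subseteq> U" "L \<subseteq> U"
  shows "N <+>\<^bsub>M\<^esub> L \<subseteq> U"
  using subsetD[OF assms(2)] subsetD[OF assms(3)] submoduleD(3)[OF assms(1)]
  by (auto simp: mem_set_add)

lemma subset_set_add:
  assumes "N \<in> fully_invariant R M" "L \<in> fully_invariant R M"
  shows "N \<subseteq> N <+>\<^bsub>M\<^esub> L" "L \<subseteq> N <+>\<^bsub>M\<^esub> L"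
proof -
  note n = fully_invariantD[OF assms(1)] and l = fully_invariantD[OF assms(2)]
  show "N \<subseteq> N <+>\<^bsub>M\<^esub> L"
    using n(2) submoduleD(2)[OF l(1)] M.r_zero unfolding subset_iff mem_set_add by metis
  show "L \<subseteq> N <+>\<^bsub>M\<^esub> L"
    using l(2) submoduleD(2)[OF n(1)] M.l_zero unfolding subset_iff mem_set_add by metis
qed

lemma set_add_eq_carrier_mono:
  assumes "N <+>\<^bsub>M\<^esub> L = carrier M" "N \<subseteq> N'" "L \<subseteq> L'" "N' \<subseteq> carrier M" "L' \<subseteq> carrier M"
  shows "N' <+>\<^bsub>M\<^esub> L' = carrier M"
proof
  show "N' <+>\<^bsub>M\<^esub> L' \<subseteq> carrier M"
    using subsetD[OF assms(4)] subsetD[OF assms(5)] by (auto simp: mem_set_add)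
  show "carrier M \<subseteq> N' <+>\<^bsub>M\<^esub> L'"
    using assms(2,3) unfolding assms(1)[symmetric] subset_iff mem_set_add by blast
qed

lemma cyclic_props:
  assumes "m \<in> carrier M"
  shows "submodule (cyclic R M m) R M" "cyclic R M m \<subseteq> carrier M" "m \<in> cyclic R M m"
proof -
  show sub: "cyclic R M m \<subseteq> carrier M"
    using assms by (auto simp: cyclic_def)
  have mem: "a \<odot>\<^bsub>M\<^esub> m \<in> cyclic R M m" if "a \<in> carrier R" for a
    using that by (auto simp: cyclic_def)
  show m: "m \<in> cyclic R M m"
    using mem[OF R.one_closed] assms by simp
  have "\<zero>\<^bsub>R\<^esub> \<odot>\<^bsub>M\<^esub> m = \<zero>\<^bsub>M\<^esub>"
    using smult_l_distr[of "\<zero>\<^bsub>R\<^esub>" "\<zero>\<^bsub>R\<^esub>" m] assms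
    by (metis M.add.r_cancel_one' R.l_zero R.zero_closed smult_closed)
  then have z: "\<zero>\<^bsub>M\<^esub> \<in> cyclic R M m"
    using mem[OF R.zero_closed] by simp
  show "submodule (cyclic R M m) R M"
  proof (rule left_submoduleI[OF left_module_axioms])
    fix x y assume "x \<in> cyclic R M m" "y \<in> cyclic R M m"
    then obtain a b where "a \<in> carrier R" "b \<in> carrier R" "x = a \<odot>\<^bsub>M\<^esub> m" "y = b \<odot>\<^bsub>M\<^esub> m"
      by (auto simp: cyclic_def)
    then show "x \<oplus>\<^bsub>M\<^esub> y \<in> cyclic R M m"
      using mem[of "a \<oplus>\<^bsub>R\<^esub> b"] assms by (simp add: smult_l_distr)
  next
    fix a x assume a: "a \<in> carrier R" and "x \<in> cyclic R M m"
    then obtain b where "b \<in> carrier R" "x = b \<odot>\<^bsub>M\<^esub> m"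
      by (auto simp: cyclic_def)
    then show "a \<odot>\<^bsub>M\<^esub> x \<in> cyclic R M m"
      using mem[of "a \<otimes>\<^bsub>R\<^esub> b"] a assms by (simp add: smult_assoc1)
  qed (use sub z in auto)
qed

lemma cyclic_subset: "submodule K R M \<Longrightarrow> m \<in> K \<Longrightarrow> cyclic R M m \<subseteq> K"
  using submoduleD(5)[of K R M] by (auto simp: cyclic_def)

section \<open>Right annihilators, and vanishing products\<close>

text \<open>The right annihilator of \<open>Y\<close> for the product, given elementwise through
  cyclic submodules. That it is a submodule is proved from projectivity in
  \<open>right_ann_props\<close>.\<close>

definition right_ann :: "'m set \<Rightarrow> 'm set"
  where "right_ann Y = {m \<in> carrier M. Y \<subseteq> ann (cyclic R M m)}"

lemma mem_Ler: "m \<in> Ler R M N \<longleftrightarrow> m \<in> carrier M \<and> N <+>\<^bsub>M\<^esub> ann (cyclic R M m) = carrier M"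
  by (simp add: Ler_def)

lemma Psi_iff_subset_Ler: "N \<in> Psi R M \<longleftrightarrow> N \<in> fully_invariant R M \<and> N \<subseteq> Ler R M N"
  using fully_invariantD(2)[of N] by (auto simp: Psi_def Ler_def)

text \<open>The product is generated by the images of \<open>N\<close> under maps from
  \<open>M\<close> to \<open>K\<close>, so it vanishes when all these images do. This turns the
  condition in \<open>r_compl\<close> into an inclusion.\<close>

lemma prod_eq_zero_iff:
  assumes N: "N \<subseteq> carrier M" "N \<noteq> {}" and K: "submodule K R M"
  shows "submod_prod R M N (sub_mod K) = {\<zero>\<^bsub>M\<^esub>} \<longleftrightarrow> N \<subseteq> ann K"
proof
  let ?G = "add_monoid (sub_mod K)" and ?U = "\<Union>f\<in>lmod_hom R M (sub_mod K). f ` N"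
  assume "submod_prod R M N (sub_mod K) = {\<zero>\<^bsub>M\<^esub>}"
  then have "?U \<subseteq> {\<zero>\<^bsub>M\<^esub>}"
    using generate.incl[of _ ?U ?G] unfolding submod_prod_def by blast
  then show "N \<subseteq> ann K"
    using N(1) by (auto simp: Ann_def)
next
  let ?G = "add_monoid (sub_mod K)" and ?U = "\<Union>f\<in>lmod_hom R M (sub_mod K). f ` N"
  assume NA: "N \<subseteq> ann K"
  interpret K: left_module R "sub_mod K"
    by (rule left_module_sub_mod[OF K left_module_axioms])
  \<comment> \<open>With the zero map at hand the union of images is exactly the zero singleton, not
    the empty set.\<close>
  have "(\<lambda>x. \<zero>\<^bsub>M\<^esub>) \<in> lmod_hom R M (sub_mod K)"
    using submoduleD(2)[OF K] by (intro homI) (auto simp: smult_zero_right)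
  then have "?U = {\<zero>\<^bsub>M\<^esub>}"
    using N(2) NA by (fastforce simp: Ann_def)
  then show "submod_prod R M N (sub_mod K) = {\<zero>\<^bsub>M\<^esub>}"
    using group.generate_one[OF K.M.a_group] by (simp add: submod_prod_def)
qed

end

section \<open>Consequences of projectivity: right annihilators, splittings,
  \<open>Ler\<close>\<close>

locale sigma_projective_module = left_module +
  assumes proj: "projective_in_sigma R M"
begin

text \<open>The direct sum of the cyclic modules \<open>R m\<close>, indexed by \<open>m\<close> together with an endomorphism,
  maps onto the submodule generated by all their images; a map from \<open>M\<close> to that submodule lifts.\<close>

lemma right_ann_props:
  assumes Y: "Y \<subseteq> carrier M"
  shows "right_ann Y \<in> fully_invariant R M" "Y \<subseteq> ann (right_ann Y)"
proof -
  define I where "I = {(g, m). g \<in> endos \<and> m \<in> right_ann Y}"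
  have I: "snd i \<in> carrier M" "Y \<subseteq> ann (cyclic R M (snd i))" "fst i \<in> endos" if "i \<in> I" for i
    using that by (auto simp: I_def right_ann_def)
  obtain W where W: "submodule W R M" "\<And>i x. i \<in> I \<Longrightarrow> x \<in> cyclic R M (snd i) \<Longrightarrow> fst i x \<in> W"
    and lift: "\<And>f. f \<in> endos \<Longrightarrow> f ` carrier M \<subseteq> W \<Longrightarrow>
      \<exists>h. (\<forall>i\<in>I. h i \<in> lmod_hom R M (sub_mod (cyclic R M (snd i)))) \<and>
        (\<forall>m\<in>carrier M. \<forall>F. finite F \<longrightarrow> F \<subseteq> I \<longrightarrow> {i \<in> I. h i m \<noteq> \<zero>\<^bsub>M\<^esub>} \<subseteq> F \<longrightarrow>
          f m = (\<Oplus>\<^bsub>M\<^esub>i\<in>F. fst i (h i m)))"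
    by (rule projective_lift_sum[OF proj, of I "\<lambda>i. cyclic R M (snd i)" fst,
          OF cyclic_props(1)[OF I(1)] I(3)]) (assumption | rule that)+
  have WM: "W \<subseteq> carrier M"
    using submoduleD(1)[OF W(1)] by auto
  have YW: "Y \<subseteq> ann W"
  proof
    fix y assume y: "y \<in> Y"
    have "f y = \<zero>\<^bsub>M\<^esub>" if f: "f \<in> endos" "f ` carrier M \<subseteq> W" for f
    proof -
      obtain h where h: "\<forall>i\<in>I. h i \<in> lmod_hom R M (sub_mod (cyclic R M (snd i)))"
        "\<forall>m\<in>carrier M. \<forall>F. finite F \<longrightarrow> F \<subseteq> I \<longrightarrow> {i \<in> I. h i m \<noteq> \<zero>\<^bsub>M\<^esub>} \<subseteq> F \<longrightarrow>
          f m = (\<Oplus>\<^bsub>M\<^esub>i\<in>F. fst i (h i m))"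
        using lift[OF f] by blast
      \<comment> \<open>Each coordinate is a map from \<open>M\<close> to some \<open>R m\<close>
        annihilated by \<open>Y\<close>. All coordinates vanish at \<open>y\<close>, so the empty
        index set contains the support.\<close>
      have "h i y = \<zero>\<^bsub>M\<^esub>" if "i \<in> I" for i
        using h(1) that I(2)[OF that] y by (auto simp: Ann_def)
      then have "{i \<in> I. h i y \<noteq> \<zero>\<^bsub>M\<^esub>} \<subseteq> {}"
        by auto
      then show ?thesis
        using h(2)[rule_format, of y "{}"] y Y by auto
    qed
    then show "y \<in> ann W"
      using y Y by (auto simp: ann_iff[OF WM])
  qed
  \<comment> \<open>The endomorphism in the index makes \<open>W\<close> contain \<open>g m\<close>
    as well as \<open>m\<close>; full invariance of \<open>right_ann Y\<close> follows once it
    equals \<open>W\<close>.\<close>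
  have gW: "g m \<in> W" if "g \<in> endos" "m \<in> right_ann Y" for g m
    using W(2)[of "(g, m)" m] that cyclic_props(3)[of m] by (auto simp: I_def right_ann_def)
  have "W \<subseteq> right_ann Y"
  proof
    fix w assume w: "w \<in> W"
    have "ann W \<subseteq> ann (cyclic R M w)"
      by (rule ann_antimono[OF cyclic_subset[OF W(1) w] WM])
    then show "w \<in> right_ann Y"
      using YW w WM by (auto simp: right_ann_def)
  qed
  moreover have "right_ann Y \<subseteq> W"
    using gW[OF endos_ident] by blast
  ultimately have eq: "right_ann Y = W" by blast
  show "Y \<subseteq> ann (right_ann Y)"
    using YW eq by simp
  show "right_ann Y \<in> fully_invariant R M"
    using W(1) gW eq by (auto simp: fully_invariant_def)
qed

text \<open>The identity of \<open>M\<close> lifts along the map from the direct sum of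
  \<open>N\<close> and \<open>L\<close> onto their sum \<open>M\<close>; \<open>p\<close> and
  \<open>q\<close> are the coordinates of the lift, indexed by \<open>True\<close> and
  \<open>False\<close>.\<close>

lemma split_identity:
  assumes N: "submodule N R M" and L: "submodule L R M" and sum: "N <+>\<^bsub>M\<^esub> L = carrier M"
  obtains p q where "p \<in> endos" "p ` carrier M \<subseteq> N" "q \<in> endos" "q ` carrier M \<subseteq> L"
    "\<And>m. m \<in> carrier M \<Longrightarrow> m = p m \<oplus>\<^bsub>M\<^esub> q m"
proof -
  define K where "K b = (if b then N else L)" for b :: bool
  have K: "submodule (K b) R M" for b
    using N L by (simp add: K_def)
  have KM: "K b \<subseteq> carrier M" for b
    using submoduleD(1)[OF K] by blast
  obtain W where W: "submodule W R M" "\<And>b x. b \<in> UNIV \<Longrightarrow> x \<in> K b \<Longrightarrow> x \<in> W"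
    and lift: "\<And>f. f \<in> endos \<Longrightarrow> f ` carrier M \<subseteq> W \<Longrightarrow>
      \<exists>h. (\<forall>b\<in>UNIV. h b \<in> lmod_hom R M (sub_mod (K b))) \<and>
        (\<forall>m\<in>carrier M. \<forall>F. finite F \<longrightarrow> F \<subseteq> UNIV \<longrightarrow> {b \<in> UNIV. h b m \<noteq> \<zero>\<^bsub>M\<^esub>} \<subseteq> F \<longrightarrow>
          f m = (\<Oplus>\<^bsub>M\<^esub>b\<in>F. h b m))"
    by (rule projective_lift_sum[OF proj, of UNIV K "\<lambda>b x. x", OF K endos_ident]) (rule that)
  have "carrier M \<subseteq> W"
    unfolding sum[symmetric] using W(2)[of True] W(2)[of False]
    by (intro set_add_subset[OF W(1)]) (auto simp: K_def)
  then have "(\<lambda>x. x) ` carrier M \<subseteq> W" by simp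
  from lift[OF endos_ident this] obtain h where
    h: "\<forall>b\<in>UNIV. h b \<in> lmod_hom R M (sub_mod (K b))"
      "\<forall>m\<in>carrier M. \<forall>F. finite F \<longrightarrow> F \<subseteq> UNIV \<longrightarrow> {b \<in> UNIV. h b m \<noteq> \<zero>\<^bsub>M\<^esub>} \<subseteq> F \<longrightarrow>
        m = (\<Oplus>\<^bsub>M\<^esub>b\<in>F. h b m)"
    by (elim exE conjE) (rule that)
  have hK: "h b \<in> endos" "h b ` carrier M \<subseteq> K b" for b
    using h(1) hom_sub_mod_iff[OF KM] by auto
  have "m = h True m \<oplus>\<^bsub>M\<^esub> h False m" if m: "m \<in> carrier M" for m
  proof -
    have "m = (\<Oplus>\<^bsub>M\<^esub>b\<in>{True, False}. h b m)"
      by (rule h(2)[rule_format, OF m]) auto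
    then show ?thesis
      using homD(1)[OF hK(1) m] by simp
  qed
  then show thesis
    using that[of "h True" "h False"] hK[of True] hK[of False] by (simp add: K_def)
qed

text \<open>As for comaximal ideals: write \<open>m = p m + q m\<close> with \<open>q m\<close> in
  \<open>A\<close>, then split \<open>q m\<close> again as \<open>p' (q m) + q' (q m)\<close>. The
  last term is in \<open>B\<close> by the choice of \<open>q'\<close>, and in \<open>A\<close>
  because \<open>A\<close> is fully invariant.\<close>

lemma set_add_Int_eq_carrier:
  assumes N: "N \<in> fully_invariant R M" and A: "A \<in> fully_invariant R M" and B: "submodule B R M"
    and NA: "N <+>\<^bsub>M\<^esub> A = carrier M" and NB: "N <+>\<^bsub>M\<^esub> B = carrier M"
  shows "N <+>\<^bsub>M\<^esub> (A \<inter> B) = carrier M"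
proof
  note n = fully_invariantD[OF N] and a = fully_invariantD[OF A]
  show "N <+>\<^bsub>M\<^esub> (A \<inter> B) \<subseteq> carrier M"
    using subsetD[OF n(2)] subsetD[OF a(2)] by (auto simp: mem_set_add)
  obtain p q where pq: "p ` carrier M \<subseteq> N" "q ` carrier M \<subseteq> A"
      "\<And>m. m \<in> carrier M \<Longrightarrow> m = p m \<oplus>\<^bsub>M\<^esub> q m"
    by (rule split_identity[OF n(1) a(1) NA]) (rule that; assumption)
  obtain p' q' where pq': "p' ` carrier M \<subseteq> N" "q' \<in> endos" "q' ` carrier M \<subseteq> B"
      "\<And>m. m \<in> carrier M \<Longrightarrow> m = p' m \<oplus>\<^bsub>M\<^esub> q' m"
    by (rule split_identity[OF n(1) B NB]) (rule that; assumption)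
  show "carrier M \<subseteq> N <+>\<^bsub>M\<^esub> (A \<inter> B)"
  proof
    fix m assume m: "m \<in> carrier M"
    define b where "b = q m"
    have b: "b \<in> A" "b \<in> carrier M"
      using pq(2) m a(2) by (auto simp: b_def)
    have c: "p m \<in> N" "p' b \<in> N" "q' b \<in> A \<inter> B"
      using pq(1) m pq'(1,3) b a(3)[OF pq'(2) b(1)] by auto
    have "m = p m \<oplus>\<^bsub>M\<^esub> (p' b \<oplus>\<^bsub>M\<^esub> q' b)"
      using pq(3)[OF m] pq'(4)[OF b(2)] by (simp add: b_def)
    also have "\<dots> = (p m \<oplus>\<^bsub>M\<^esub> p' b) \<oplus>\<^bsub>M\<^esub> q' b"
      using c n(2) a(2) by (intro M.a_assoc[symmetric]) auto
    finally show "m \<in> N <+>\<^bsub>M\<^esub> (A \<inter> B)"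
      unfolding mem_set_add using c submoduleD(3)[OF n(1)] by blast
  qed
qed

lemma right_ann_subset_Ler:
  assumes "Y \<subseteq> carrier M" "N \<subseteq> carrier M" "N <+>\<^bsub>M\<^esub> Y = carrier M"
  shows "right_ann Y \<subseteq> Ler R M N"
proof
  fix m assume m: "m \<in> right_ann Y"
  then have "m \<in> carrier M" "Y \<subseteq> ann (cyclic R M m)"
    by (auto simp: right_ann_def)
  then show "m \<in> Ler R M N"
    using set_add_eq_carrier_mono[OF assms(3) order_refl _ assms(2)]
    by (auto simp: mem_Ler Ann_def)
qed

text \<open>\<open>Ler R M N\<close> is the union of the sets \<open>right_ann Y\<close> with
  \<open>N + Y = M\<close>, each fully invariant. The union is closed under addition because the
  family is directed: two such annihilators \<open>Y\<close> may be replaced by their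
  intersection.\<close>

lemma Ler_fully_invariant:
  assumes N: "N \<in> fully_invariant R M"
  shows "Ler R M N \<in> fully_invariant R M"
proof -
  note n = fully_invariantD[OF N]
  have LM: "Ler R M N \<subseteq> carrier M"
    by (auto simp: Ler_def)
  have A: "ann (cyclic R M m) \<in> fully_invariant R M" if "m \<in> carrier M" for m
    by (rule ann_fully_invariant[OF cyclic_props(2)[OF that]])
  have cl: "right_ann (ann (cyclic R M m)) \<subseteq> Ler R M N"
    "right_ann (ann (cyclic R M m)) \<in> fully_invariant R M"
    "m \<in> right_ann (ann (cyclic R M m))" if "m \<in> Ler R M N" for m
  proof -
    have m: "m \<in> carrier M" "N <+>\<^bsub>M\<^esub> ann (cyclic R M m) = carrier M"
      using that by (auto simp: mem_Ler)
    note a = fully_invariantD(2)[OF A[OF m(1)]]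
    show "right_ann (ann (cyclic R M m)) \<subseteq> Ler R M N"
      by (rule right_ann_subset_Ler[OF a n(2) m(2)])
    show "right_ann (ann (cyclic R M m)) \<in> fully_invariant R M"
      by (rule right_ann_props(1)[OF a])
    show "m \<in> right_ann (ann (cyclic R M m))"
      using m by (simp add: right_ann_def)
  qed
  have "submodule (Ler R M N) R M"
  proof (rule left_submoduleI[OF left_module_axioms])
    have "N <+>\<^bsub>M\<^esub> carrier M = carrier M"
      using set_add_subset[OF fully_invariantD(1)[OF carrier_fully_invariant] n(2) order_refl]
        subset_set_add(2)[OF N carrier_fully_invariant] by blast
    then have "right_ann (carrier M) \<subseteq> Ler R M N"
      by (intro right_ann_subset_Ler[OF order_refl n(2)])
    then show "\<zero>\<^bsub>M\<^esub> \<in> Ler R M N"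
      using submoduleD(2)[OF fully_invariantD(1)[OF right_ann_props(1)[OF order_refl]]] by blast
  next
    fix x y assume x: "x \<in> Ler R M N" and y: "y \<in> Ler R M N"
    let ?A = "ann (cyclic R M x)" and ?B = "ann (cyclic R M y)"
    have xy: "x \<in> carrier M" "y \<in> carrier M" "N <+>\<^bsub>M\<^esub> ?A = carrier M" "N <+>\<^bsub>M\<^esub> ?B = carrier M"
      using x y by (auto simp: mem_Ler)
    note A1 = A[OF xy(1)] and B1 = A[OF xy(2)]
    have AB: "?A \<inter> ?B \<subseteq> carrier M"
      using fully_invariantD(2)[OF A1] by blast
    have "x \<in> right_ann (?A \<inter> ?B)" "y \<in> right_ann (?A \<inter> ?B)"
      using xy by (auto simp: right_ann_def)
    then have "x \<oplus>\<^bsub>M\<^esub> y \<in> right_ann (?A \<inter> ?B)"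
      using submoduleD(3)[OF fully_invariantD(1)[OF right_ann_props(1)[OF AB]]] by blast
    then show "x \<oplus>\<^bsub>M\<^esub> y \<in> Ler R M N"
      using right_ann_subset_Ler[OF AB n(2)
          set_add_Int_eq_carrier[OF N A1 fully_invariantD(1)[OF B1] xy(3,4)]] by blast
  next
    fix a x assume "a \<in> carrier R" "x \<in> Ler R M N"
    then show "a \<odot>\<^bsub>M\<^esub> x \<in> Ler R M N"
      using cl[of x] submoduleD(5)[OF fully_invariantD(1)] by blast
  qed (use LM in auto)
  moreover have "f m \<in> Ler R M N" if "f \<in> endos" "m \<in> Ler R M N" for f m
    using cl[OF that(2)] fully_invariantD(3) that(1) by blast
  ultimately show ?thesis
    by (auto simp: fully_invariant_def)
qed

end

section \<open>Semiprimeness and symmetry of annihilation\<close>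

locale ann_Ler_closed_module = sigma_projective_module +
  assumes Ler_ann: "\<And>K. K \<in> fully_invariant R M \<Longrightarrow> Ler R M (ann K) = ann K"
begin

lemma ann_mem_Psi: "K \<in> fully_invariant R M \<Longrightarrow> ann K \<in> Psi R M"
  using Ler_ann ann_fully_invariant fully_invariantD(2) by (auto simp: Psi_iff_subset_Ler)

text \<open>A form of semiprimeness. For \<open>n\<close> in \<open>Z\<close> the hypothesis gives
  \<open>ann Z + ann (R n) = M\<close>; as \<open>ann Z\<close> lies in \<open>ann (R n)\<close>,
  the latter is all of \<open>M\<close>, and so \<open>n\<close> lies in \<open>Ler\<close> of
  zero.\<close>

lemma eq_zero_if_subset_ann:
  assumes Z: "Z \<in> fully_invariant R M" "Z \<subseteq> ann Z"
  shows "Z = {\<zero>\<^bsub>M\<^esub>}"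
proof -
  note z = fully_invariantD[OF Z(1)]
  have "n = \<zero>\<^bsub>M\<^esub>" if n: "n \<in> Z" for n
  proof -
    let ?A = "ann (cyclic R M n)"
    have nM: "n \<in> carrier M"
      using n z(2) by auto
    note A = ann_fully_invariant[OF cyclic_props(2)[OF nM]]
    have "n \<in> Ler R M (ann Z)"
      using n Z Ler_ann by auto
    then have "ann Z <+>\<^bsub>M\<^esub> ?A = carrier M"
      by (simp add: mem_Ler)
    moreover have "ann Z <+>\<^bsub>M\<^esub> ?A \<subseteq> ?A"
      using ann_antimono[OF cyclic_subset[OF z(1) n] z(2)]
      by (intro set_add_subset[OF fully_invariantD(1)[OF A]]) auto
    ultimately have "?A = carrier M"
      using fully_invariantD(2)[OF A] by blast
    \<comment> \<open>Zero is written as the annihilator of \<open>M\<close>, to which the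
      hypothesis on \<open>Ler\<close> applies.\<close>
    then have "ann (carrier M) <+>\<^bsub>M\<^esub> ?A = carrier M"
      unfolding ann_carrier using subset_set_add(2)[OF zero_fully_invariant A]
        fully_invariantD(2)[OF add_fully_invariant[OF zero_fully_invariant A]] by simp
    then have "n \<in> Ler R M (ann (carrier M))"
      using nM by (simp add: mem_Ler)
    then show "n = \<zero>\<^bsub>M\<^esub>"
      using Ler_ann[OF carrier_fully_invariant] by (simp add: ann_self)
  qed
  then show ?thesis
    using submoduleD(2)[OF z(1)] by blast
qed

text \<open>From \<open>Y \<subseteq> ann X\<close> the intersection of \<open>X\<close> and
  \<open>Y\<close> annihilates itself, hence is zero. A map from \<open>M\<close> to
  \<open>Y\<close> sends \<open>X\<close> into this intersection, because \<open>X\<close> is fully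
  invariant.\<close>

lemma ann_commute:
  assumes X: "X \<in> fully_invariant R M" and Y: "Y \<in> fully_invariant R M" and XY: "Y \<subseteq> ann X"
  shows "X \<subseteq> ann Y"
proof -
  note x = fully_invariantD[OF X] and y = fully_invariantD[OF Y]
  have "X \<inter> Y \<subseteq> ann (X \<inter> Y)"
    using order_trans[OF XY ann_antimono[OF Int_lower1 x(2)]] by (rule le_infI2)
  then have Z: "X \<inter> Y = {\<zero>\<^bsub>M\<^esub>}"
    by (rule eq_zero_if_subset_ann[OF Int_fully_invariant[OF X Y]])
  have "f s = \<zero>\<^bsub>M\<^esub>" if "s \<in> X" "f \<in> endos" "f ` carrier M \<subseteq> Y" for s f
  proof -
    have "f s \<in> X \<inter> Y"
      using x(3)[OF that(2,1)] that(1,3) x(2) by auto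
    then show ?thesis
      by (simp add: Z)
  qed
  then show ?thesis
    using subsetD[OF x(2)] unfolding subset_iff ann_iff[OF y(2)] by simp
qed

lemma Ler_subset:
  assumes N: "N \<in> fully_invariant R M"
  shows "Ler R M N \<subseteq> N"
proof
  fix m assume m: "m \<in> Ler R M N"
  let ?A = "ann (cyclic R M m)"
  note n = fully_invariantD[OF N]
  have mM: "m \<in> carrier M" and NA: "N <+>\<^bsub>M\<^esub> ?A = carrier M"
    using m by (auto simp: mem_Ler)
  have A: "?A \<in> fully_invariant R M"
    by (rule ann_fully_invariant[OF cyclic_props(2)[OF mM]])
  note a = fully_invariantD[OF A]
  obtain p q where pq: "p ` carrier M \<subseteq> N" "q \<in> endos" "q ` carrier M \<subseteq> ?A"
      "\<And>m. m \<in> carrier M \<Longrightarrow> m = p m \<oplus>\<^bsub>M\<^esub> q m"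
    by (rule split_identity[OF n(1) a(1) NA]) (rule that; assumption)
  \<comment> \<open>\<open>ann_commute\<close> asks for fully invariant submodules, so
    \<open>R m\<close> is replaced by \<open>right_ann ?A\<close>, which contains \<open>m\<close>
    and is still annihilated by \<open>?A\<close>. Then \<open>m\<close> is in
    \<open>ann ?A\<close>, and \<open>q\<close>, mapping into \<open>?A\<close>, kills it.\<close>
  have "m \<in> right_ann ?A"
    using mM by (simp add: right_ann_def)
  then have "m \<in> ann ?A"
    by (rule subsetD[OF ann_commute[OF right_ann_props(1)[OF a(2)] A right_ann_props(2)[OF a(2)]]])
  then have "q m = \<zero>\<^bsub>M\<^esub>"
    using pq(2,3) by (simp add: ann_iff[OF a(2)])
  moreover have p: "p m \<in> N"
    using pq(1) mM by blast
  ultimately have "p m \<oplus>\<^bsub>M\<^esub> q m \<in> N"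
    using M.r_zero[OF subsetD[OF n(2) p]] by simp
  then show "m \<in> N"
    by (simp only: pq(4)[OF mM, symmetric])
qed

lemma Psi_iff_Ler_eq: "N \<in> Psi R M \<longleftrightarrow> N \<in> fully_invariant R M \<and> Ler R M N = N"
  using Ler_subset by (auto simp: Psi_iff_subset_Ler)

text \<open>The witness is \<open>x = ann (ann (R m))\<close>. Being an annihilator it is in
  \<open>Psi R M\<close>, and \<open>ann x\<close> contains \<open>ann (R m)\<close> by symmetry.
  Hence the supremum defining \<open>r\<close> captures \<open>m\<close> in any carrier that
  contains \<open>Psi R M\<close>.\<close>

lemma mem_Ler_double_ann:
  assumes N: "N \<in> fully_invariant R M" and m: "m \<in> Ler R M N"
  obtains x where "x \<in> Psi R M" "m \<in> x" "N <+>\<^bsub>M\<^esub> ann x = carrier M"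
proof -
  let ?A = "ann (cyclic R M m)"
  have mM: "m \<in> carrier M" and NA: "N <+>\<^bsub>M\<^esub> ?A = carrier M"
    using m by (auto simp: mem_Ler)
  have A: "?A \<in> fully_invariant R M"
    by (rule ann_fully_invariant[OF cyclic_props(2)[OF mM]])
  note a = fully_invariantD[OF A]
  have AA: "ann ?A \<in> fully_invariant R M"
    by (rule ann_fully_invariant[OF a(2)])
  note aa = fully_invariantD[OF AA]
  have "m \<in> right_ann ?A"
    using mM by (simp add: right_ann_def)
  then have mA: "m \<in> ann ?A"
    by (rule subsetD[OF ann_commute[OF right_ann_props(1)[OF a(2)] A right_ann_props(2)[OF a(2)]]])
  have "?A \<subseteq> ann (ann ?A)"
    by (rule ann_commute[OF A AA order_refl])
  then have "N <+>\<^bsub>M\<^esub> ann (ann ?A) = carrier M"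
    by (rule set_add_eq_carrier_mono[OF NA order_refl _ fully_invariantD(2)[OF N]
          fully_invariantD(2)[OF ann_fully_invariant[OF aa(2)]]])
  then show thesis
    using that ann_mem_Psi[OF A] mA by blast
qed

lemma subset_Ler:
  assumes N: "N \<in> fully_invariant R M" and x: "x \<in> fully_invariant R M"
    and sum: "N <+>\<^bsub>M\<^esub> ann x = carrier M"
  shows "x \<subseteq> Ler R M N"
proof
  fix m assume m: "m \<in> x"
  note x' = fully_invariantD[OF x]
  have mM: "m \<in> carrier M"
    using m x'(2) by auto
  have "ann x \<subseteq> ann (cyclic R M m)"
    by (rule ann_antimono[OF cyclic_subset[OF x'(1) m] x'(2)])
  then have "N <+>\<^bsub>M\<^esub> ann (cyclic R M m) = carrier M"
    by (rule set_add_eq_carrier_mono[OF sum order_refl _ fully_invariantD(2)[OF N]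
          fully_invariantD(2)[OF ann_fully_invariant[OF cyclic_props(2)[OF mM]]]])
  then show "m \<in> Ler R M N"
    using mM by (simp add: mem_Ler)
qed

section \<open>The operator \<open>r\<close> on carriers containing \<open>Psi R M\<close>\<close>

text \<open>Annihilators lie in \<open>Psi R M\<close>, hence in \<open>S\<close>, so zero,
  \<open>M\<close> and the elements \<open>r_compl x\<close> are the same in \<open>S\<close> as in
  the whole lattice; joins are sums by closure. Thus \<open>r\<close> on \<open>S\<close> is
  \<open>Ler\<close>, whose fixed points are \<open>Psi R M\<close>. A general \<open>S\<close>
  treats both the first and the second step of the chain.\<close>

lemma r_fixed_eq_Psi:
  assumes S: "Psi R M \<subseteq> S" "S \<subseteq> fully_invariant R M"
    and add: "\<And>N L. N \<in> S \<Longrightarrow> L \<in> S \<Longrightarrow> N <+>\<^bsub>M\<^esub> L \<in> S"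
    and Ler: "\<And>N. N \<in> S \<Longrightarrow> Ler R M N \<in> S"
  shows "r_fixed (fi_quantale R M\<lparr>carrier := S\<rparr>) = Psi R M"
proof -
  let ?A = "fi_quantale R M\<lparr>carrier := S\<rparr>"
  interpret set_order ?A
    by standard (simp_all add: fi_quantale_def)
  have fi: "N \<in> fully_invariant R M" if "N \<in> S" for N
    using S(2) that by blast
  have annS: "ann N \<in> S" if "N \<in> fully_invariant R M" for N
    using S(1) ann_mem_Psi[OF that] by blast
  \<comment> \<open>Zero is the annihilator of \<open>M\<close>, and \<open>M\<close> that of zero,
    so both belong to \<open>S\<close>.\<close>
  have bot: "\<bottom>\<^bsub>?A\<^esub> = {\<zero>\<^bsub>M\<^esub>}"
    using annS[OF carrier_fully_invariant] submoduleD(2)[OF fully_invariantD(1)[OF fi]]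
    by (intro bot_eqI) (auto simp: ann_self)
  have top: "\<top>\<^bsub>?A\<^esub> = carrier M"
    using annS[OF zero_fully_invariant] fully_invariantD(2)[OF fi]
    by (intro top_eqI) (auto simp: ann_zero)
  have mult: "N \<star>\<^bsub>?A\<^esub> L = submod_prod R M N (sub_mod L)" for N L
    by (simp add: fi_quantale_def)
  have prod: "N \<star>\<^bsub>?A\<^esub> L = \<bottom>\<^bsub>?A\<^esub> \<longleftrightarrow> N \<subseteq> ann L" if "N \<in> S" "L \<in> S" for N L
    unfolding mult bot using fully_invariantD[OF fi[OF that(1)]] fully_invariantD[OF fi[OF that(2)]]
      submoduleD(2)[of N R M]
    by (intro prod_eq_zero_iff) auto
  \<comment> \<open>The supremum is attained: \<open>ann x\<close> is itself a member of the set and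
    its largest one.\<close>
  have compl: "r_compl ?A x = ann x" if x: "x \<in> S" for x
    unfolding r_compl_def using prod[OF _ x] annS[OF fi[OF x]]
    by (intro sup_eqI) auto
  have join: "N \<squnion>\<^bsub>?A\<^esub> L = N <+>\<^bsub>M\<^esub> L" if N: "N \<in> S" and L: "L \<in> S" for N L
    unfolding join_def
  proof (rule sup_eqI)
    fix u assume "u \<in> carrier ?A" "\<And>x. x \<in> {N, L} \<Longrightarrow> x \<subseteq> u"
    then show "N <+>\<^bsub>M\<^esub> L \<subseteq> u"
      using fully_invariantD(1)[OF fi[of u]] by (intro set_add_subset) auto
  qed (use add[OF N L] N L subset_set_add[OF fi[OF N] fi[OF L]] in auto)
  have r: "r_op ?A N = Ler R M N" if N: "N \<in> S" for N
  proof -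
    have eq: "{x \<in> carrier ?A. N \<squnion>\<^bsub>?A\<^esub> r_compl ?A x = \<top>\<^bsub>?A\<^esub>} =
        {x \<in> S. N <+>\<^bsub>M\<^esub> ann x = carrier M}"
      using compl join[OF N annS[OF fi]] by (auto simp: top)
    show ?thesis
      unfolding r_op_def eq
    proof (rule sup_eqI)
      fix u assume u: "u \<in> carrier ?A" "\<And>x. x \<in> {x \<in> S. N <+>\<^bsub>M\<^esub> ann x = carrier M} \<Longrightarrow> x \<subseteq> u"
      show "Ler R M N \<subseteq> u"
      proof
        fix m assume "m \<in> Ler R M N"
        then obtain x where "x \<in> Psi R M" "m \<in> x" "N <+>\<^bsub>M\<^esub> ann x = carrier M"
          by (rule mem_Ler_double_ann[OF fi[OF N]])
        then show "m \<in> u"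
          using u(2)[of x] S(1) by auto
      qed
    qed (use Ler[OF N] subset_Ler[OF fi[OF N] fi] in auto)
  qed
  show ?thesis
    using r S by (auto simp: r_fixed_def Psi_iff_Ler_eq)
qed

lemma Ler_mono:
  assumes "N \<subseteq> L" "L \<subseteq> carrier M"
  shows "Ler R M N \<subseteq> Ler R M L"
  using set_add_eq_carrier_mono[OF _ assms(1) order_refl assms(2)]
  by (auto simp: mem_Ler Ann_def)

text \<open>Since \<open>Ler\<close> is monotone, both summands lie in \<open>Ler\<close> of the
  sum, which is a submodule. This is the closure needed to take \<open>S = Psi R M\<close> in
  \<open>r_fixed_eq_Psi\<close>.\<close>

lemma add_mem_Psi:
  assumes N: "N \<in> Psi R M" and L: "L \<in> Psi R M"
  shows "N <+>\<^bsub>M\<^esub> L \<in> Psi R M"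
proof -
  have fi: "N \<in> fully_invariant R M" "L \<in> fully_invariant R M"
    and sub: "N \<subseteq> Ler R M N" "L \<subseteq> Ler R M L"
    using N L by (auto simp: Psi_iff_subset_Ler)
  note S = add_fully_invariant[OF fi]
  have "N <+>\<^bsub>M\<^esub> L \<subseteq> Ler R M (N <+>\<^bsub>M\<^esub> L)"
    using sub Ler_mono[OF subset_set_add(1)[OF fi]] Ler_mono[OF subset_set_add(2)[OF fi]]
      fully_invariantD(2)[OF S]
    by (intro set_add_subset[OF fully_invariantD(1)[OF Ler_fully_invariant[OF S]]]) auto
  then show ?thesis
    using S by (simp add: Psi_iff_subset_Ler)
qed

theorem regular_core_eq_Psi: "regular_core (fi_quantale R M) = Psi R M"
proof (rule regular_core_eqI)
  \<comment> \<open>The carrier is replaced by itself to bring the first step into the form of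
    \<open>r_fixed_eq_Psi\<close>.\<close>
  have "r_fixed (fi_quantale R M\<lparr>carrier := fully_invariant R M\<rparr>) = Psi R M"
    by (rule r_fixed_eq_Psi) (auto simp: Psi_def add_fully_invariant Ler_fully_invariant)
  then show "r_fixed (fi_quantale R M) = Psi R M"
    by (simp add: fi_quantale_def)
  show "r_fixed (fi_quantale R M\<lparr>carrier := Psi R M\<rparr>) = Psi R M"
    by (rule r_fixed_eq_Psi) (simp_all add: add_mem_Psi, auto simp: Psi_iff_Ler_eq)
qed

end

theorem theorem5p20:
  fixes R :: "('r, 'q) ring_scheme" and M :: "('r, 'm, 's) module_scheme"
  assumes "left_module R M"
    and "projective_in_sigma R M"
    and "\<forall>K\<in>fully_invariant R M.
      Ler R M (Ann R M (M\<lparr>carrier := K\<rparr>)) = Ann R M (M\<lparr>carrier := K\<rparr>)"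
  shows "Psi R M = regular_core (fi_quantale R M)"
proof -
  interpret left_module R M by fact
  interpret ann_Ler_closed_module R M
    by standard (use assms in auto)
  show ?thesis
    by (rule regular_core_eq_Psi[symmetric])
qed

end
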